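(* Let $l: G \to \mathbb{R}_{\geq 0}$ be a graph-like length function on a group $G$. Then $l$ is bi-Lipschitz equivalent to some (and hence to all) based length function $l_p$ arising from a locally compact, co-compact, metric $G$-graph and a point $p$ of it with $\mathrm{Stab}(p)=1$. That is, there exist a locally compact, co-compact metric $G$-graph $\Gamma$ and a point $p\in\Gamma$ with $\mathrm{Stab}(p)=1$ such that $l$ is bi-Lipschitz equivalent to $l_p$; and $l$ is bi-Lipschitz equivalent to $l_q$ for every locally compact, co-compact metric $G$-graph $Y$ and every $q\in Y$ with $\mathrm{Stab}(q)=1$.
   Context: For a function $l:G\to\mathbb{R}_{\ge0}$ put $c(g,h) := \frac{1}{2}(l(g)+l(h)-l(gh^{-1}))$. The function $l$ is a graph-like length function if: (A1) $l(g)=0$ if and only if $g=1$; (A2) $l(g^{-1})=l(g)$ for all $g\in G$; (A3) $c(g,h)\ge 0$ for all $g,h\in G$; (A4) for all $R\ge 0$, the closed ball $B_R:=\{g\in G \mid l(g)\le R\}$ is finite; (A5) there exist $0\le\epsilon<1$ and $K>0$ such that, for any $g\in G$ with $l(g)>K$, there exists $x\in G$ with (i) $0<l(x)\le K$ and (ii) $c(gx^{-1},x^{-1})\le \frac{\epsilon\, l(x)}{2}$. A metric graph is a (connected) 1-dimensional CW-complex with a metric structure (each edge has a positive real length), equipped with the path metric. A metric $G$-graph is a metric graph $\Gamma$ together with an isometric right action of $G$ on $\Gamma$ sending vertices to vertices and edges to edges; it is co-compact if the quotient by $G$ is compact. For $p\in\Gamma$, the based length function is $l_p(g):=d_\Gamma(p,pg)$,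 and $\mathrm{Stab}(p)=\{g\in G\mid pg=p\}$. Functions $l_1,l_2:G\to\mathbb{R}_{\ge0}$ are bi-Lipschitz equivalent if there is $A\ge1$ with $\frac1A l_1(g)\le l_2(g)\le A\,l_1(g)$ for all $g\in G$. *)

theory Defs
  imports "HOL-Algebra.Group_Action" "HOL-Analysis.Analysis"
begin

section \<open>Graph-like length functions\<close>

definition gromov_product ::
    "('a, 'm) monoid_scheme \<Rightarrow> ('a \<Rightarrow> real) \<Rightarrow> 'a \<Rightarrow> 'a \<Rightarrow> real" where
  "gromov_product G l g h = (l g + l h - l (g \<otimes>\<^bsub>G\<^esub> inv\<^bsub>G\<^esub> h)) / 2"

locale graph_like_length = group G for G :: "('a, 'm) monoid_scheme" (structure) +
  fixes l :: "'a \<Rightarrow> real"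
  assumes nonneg: "g \<in> carrier G \<Longrightarrow> 0 \<le> l g"
    and A1: "g \<in> carrier G \<Longrightarrow> l g = 0 \<longleftrightarrow> g = \<one>"
    and A2: "g \<in> carrier G \<Longrightarrow> l (inv g) = l g"
    and A3: "g \<in> carrier G \<Longrightarrow> h \<in> carrier G \<Longrightarrow> 0 \<le> gromov_product G l g h"
    and A4: "0 \<le> R \<Longrightarrow> finite {g \<in> carrier G. l g \<le> R}"
    and A5: "\<exists>\<epsilon> K. 0 \<le> \<epsilon> \<and> \<epsilon> < 1 \<and> 0 < K \<and>
      (\<forall>g \<in> carrier G. K < l g \<longrightarrow>
        (\<exists>x \<in> carrier G. 0 < l x \<and> l x \<le> K \<and>
          gromov_product G l (g \<otimes> inv x) (inv x) \<le> \<epsilon> * l x / 2))"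

definition bi_Lipschitz_equivalent_on :: "'a set \<Rightarrow> ('a \<Rightarrow> real) \<Rightarrow> ('a \<Rightarrow> real) \<Rightarrow> bool" where
  "bi_Lipschitz_equivalent_on S l\<^sub>1 l\<^sub>2 \<longleftrightarrow>
     (\<exists>A \<ge> 1. \<forall>g \<in> S. 1 / A * l\<^sub>1 g \<le> l\<^sub>2 g \<and> l\<^sub>2 g \<le> A * l\<^sub>1 g)"


section \<open>Metric graphs\<close>

text \<open>
  A one-dimensional CW complex with edge lengths is given by its vertices, its edges (with an
  arbitrary orientation; loops and multiple edges are allowed), the attaching data
  \<open>origin\<close>, \<open>terminus\<close> and the lengths. Its points are the vertices together with, for each
  edge \<open>e\<close>, the points \<open>Inner e t\<close> at distance \<open>t\<close> along \<open>e\<close> from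
  its initial vertex, where \<open>0 < t < len e\<close>.
\<close>

record ('v, 'e) edge_data =
  verts :: "'v set"
  edges :: "'e set"
  origin :: "'e \<Rightarrow> 'v"
  terminus :: "'e \<Rightarrow> 'v"
  len :: "'e \<Rightarrow> real"

datatype ('v, 'e) point = Vertex 'v | Inner 'e real

definition open_edge :: "('v, 'e) edge_data \<Rightarrow> 'e \<Rightarrow> ('v, 'e) point set" where
  "open_edge \<Gamma> e = Inner e ` {0 <..< len \<Gamma> e}"

definition points :: "('v, 'e) edge_data \<Rightarrow> ('v, 'e) point set" where
  "points \<Gamma> = Vertex ` verts \<Gamma> \<union> (\<Union>e \<in> edges \<Gamma>. open_edge \<Gamma> e)"

text \<open>The characteristic map of the cell \<open>e\<close>, used on \<open>{0..len \<Gamma> e}\<close> only.\<close>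

definition char_map :: "('v, 'e) edge_data \<Rightarrow> 'e \<Rightarrow> real \<Rightarrow> ('v, 'e) point" where
  "char_map \<Gamma> e t =
     (if t \<le> 0 then Vertex (origin \<Gamma> e)
      else if len \<Gamma> e \<le> t then Vertex (terminus \<Gamma> e)
      else Inner e t)"

text \<open>
  The weak topology of the CW complex. It can be finer than the topology of the path distance
  below (at vertices of infinite valence), but both agree on a graph that is locally compact and
  co-compact for the weak topology: such a graph is locally finite, with finitely many edge lengths.
\<close>

definition cw_topology :: "('v, 'e) edge_data \<Rightarrow> ('v, 'e) point topology" where
  "cw_topology \<Gamma> = topology (\<lambda>U. U \<subseteq> points \<Gamma> \<and>
     (\<forall>e \<in> edges \<Gamma>. openin (top_of_set {0..len \<Gamma> e}) {t \<in> {0..len \<Gamma> e}. char_map \<Gamma> e t \<in> U}))"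

lemma openin_cw_topology:
  "openin (cw_topology \<Gamma>) U \<longleftrightarrow> U \<subseteq> points \<Gamma> \<and>
     (\<forall>e \<in> edges \<Gamma>. openin (top_of_set {0..len \<Gamma> e}) {t \<in> {0..len \<Gamma> e}. char_map \<Gamma> e t \<in> U})"
proof -
  have "istopology (\<lambda>U. U \<subseteq> points \<Gamma> \<and>
     (\<forall>e \<in> edges \<Gamma>. openin (top_of_set {0..len \<Gamma> e}) {t \<in> {0..len \<Gamma> e}. char_map \<Gamma> e t \<in> U}))"
    unfolding istopology_def
  proof (intro conjI allI impI ballI)
    fix S T e
    assume "S \<subseteq> points \<Gamma> \<and> (\<forall>e \<in> edges \<Gamma>. openin (top_of_set {0..len \<Gamma> e}) {t \<in> {0..len \<Gamma> e}. char_map \<Gamma> e t \<in> S})"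
      and "T \<subseteq> points \<Gamma> \<and> (\<forall>e \<in> edges \<Gamma>. openin (top_of_set {0..len \<Gamma> e}) {t \<in> {0..len \<Gamma> e}. char_map \<Gamma> e t \<in> T})"
      and "e \<in> edges \<Gamma>"
    then have "openin (top_of_set {0..len \<Gamma> e})
        ({t \<in> {0..len \<Gamma> e}. char_map \<Gamma> e t \<in> S} \<inter> {t \<in> {0..len \<Gamma> e}. char_map \<Gamma> e t \<in> T})"
      by blast
    moreover have "{t \<in> {0..len \<Gamma> e}. char_map \<Gamma> e t \<in> S} \<inter> {t \<in> {0..len \<Gamma> e}. char_map \<Gamma> e t \<in> T}
        = {t \<in> {0..len \<Gamma> e}. char_map \<Gamma> e t \<in> S \<inter> T}"
      by blast
    ultimately show "openin (top_of_set {0..len \<Gamma> e}) {t \<in> {0..len \<Gamma> e}. char_map \<Gamma> e t \<in> S \<inter> T}"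
      by simp
  next
    fix \<K> e
    assume "\<forall>S \<in> \<K>. S \<subseteq> points \<Gamma> \<and>
        (\<forall>e \<in> edges \<Gamma>. openin (top_of_set {0..len \<Gamma> e}) {t \<in> {0..len \<Gamma> e}. char_map \<Gamma> e t \<in> S})"
      and "e \<in> edges \<Gamma>"
    then have "openin (top_of_set {0..len \<Gamma> e})
        (\<Union>S \<in> \<K>. {t \<in> {0..len \<Gamma> e}. char_map \<Gamma> e t \<in> S})"
      by blast
    moreover have "(\<Union>S \<in> \<K>. {t \<in> {0..len \<Gamma> e}. char_map \<Gamma> e t \<in> S})
        = {t \<in> {0..len \<Gamma> e}. char_map \<Gamma> e t \<in> \<Union>\<K>}"
      by blast
    ultimately show "openin (top_of_set {0..len \<Gamma> e}) {t \<in> {0..len \<Gamma> e}. char_map \<Gamma> e t \<in> \<Union>\<K>}"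
      by simp
  qed blast+
  then show ?thesis
    unfolding cw_topology_def by (simp add: topology_inverse')
qed

text \<open>
  \<open>pl_path \<Gamma> x L y\<close>: there is a piecewise linear path of length \<open>L\<close> from
  \<open>x\<close> to \<open>y\<close>, that is, a concatenation of finitely many segments, each running
  inside one closed edge.
\<close>

inductive pl_path :: "('v, 'e) edge_data \<Rightarrow> ('v, 'e) point \<Rightarrow> real \<Rightarrow> ('v, 'e) point \<Rightarrow> bool"
  for \<Gamma> where
    trivial: "x \<in> points \<Gamma> \<Longrightarrow> pl_path \<Gamma> x 0 x"
  | segment: "\<lbrakk>pl_path \<Gamma> x L (char_map \<Gamma> e s); e \<in> edges \<Gamma>;
       s \<in> {0..len \<Gamma> e}; t \<in> {0..len \<Gamma> e}\<rbrakk>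
       \<Longrightarrow> pl_path \<Gamma> x (L + \<bar>t - s\<bar>) (char_map \<Gamma> e t)"

text \<open>
  The value outside \<open>points \<Gamma>\<close> is fixed because the library's \<open>Metric_space\<close>
  requires nonnegativity and symmetry on the whole type.
\<close>

definition path_dist :: "('v, 'e) edge_data \<Rightarrow> ('v, 'e) point \<Rightarrow> ('v, 'e) point \<Rightarrow> real" where
  "path_dist \<Gamma> x y =
     (if x \<in> points \<Gamma> \<and> y \<in> points \<Gamma> then Inf {L. pl_path \<Gamma> x L y} else 0)"

text \<open>
  The path distance is in general only a pseudometric (two vertices may be joined by
  arbitrarily short edges), so that it separates points has to be required.
\<close>

locale metric_graph =
  fixes \<Gamma> :: "('v, 'e) edge_data"
  assumes edges_nonempty: "edges \<Gamma> \<noteq> {}"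
    and origin_in_verts: "e \<in> edges \<Gamma> \<Longrightarrow> origin \<Gamma> e \<in> verts \<Gamma>"
    and terminus_in_verts: "e \<in> edges \<Gamma> \<Longrightarrow> terminus \<Gamma> e \<in> verts \<Gamma>"
    and len_pos: "e \<in> edges \<Gamma> \<Longrightarrow> 0 < len \<Gamma> e"
    and connected: "connected_space (cw_topology \<Gamma>)"
    and metric: "Metric_space (points \<Gamma>) (path_dist \<Gamma>)"


section \<open>Metric \<open>G\<close>-graphs\<close>

text \<open>\<open>\<phi> g x\<close> stands for \<open>x g\<close>; note the order of the factors in \<open>act_mult\<close>.\<close>

locale metric_G_graph = group G + metric_graph \<Gamma>
  for G :: "('a, 'm) monoid_scheme" (structure)
    and \<Gamma> :: "('v, 'e) edge_data" +
  fixes \<phi> :: "'a \<Rightarrow> ('v, 'e) point \<Rightarrow> ('v, 'e) point"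
  assumes act_closed: "g \<in> carrier G \<Longrightarrow> x \<in> points \<Gamma> \<Longrightarrow> \<phi> g x \<in> points \<Gamma>"
    and act_one: "x \<in> points \<Gamma> \<Longrightarrow> \<phi> \<one> x = x"
    and act_mult: "g \<in> carrier G \<Longrightarrow> h \<in> carrier G \<Longrightarrow> x \<in> points \<Gamma> \<Longrightarrow>
      \<phi> (g \<otimes> h) x = \<phi> h (\<phi> g x)"
    and act_isometric: "g \<in> carrier G \<Longrightarrow> x \<in> points \<Gamma> \<Longrightarrow> y \<in> points \<Gamma> \<Longrightarrow>
      path_dist \<Gamma> (\<phi> g x) (\<phi> g y) = path_dist \<Gamma> x y"
    and act_vertex: "g \<in> carrier G \<Longrightarrow> v \<in> verts \<Gamma> \<Longrightarrow> \<phi> g (Vertex v) \<in> Vertex ` verts \<Gamma>"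
    and act_edge: "g \<in> carrier G \<Longrightarrow> e \<in> edges \<Gamma> \<Longrightarrow>
      \<exists>e' \<in> edges \<Gamma>. \<phi> g ` open_edge \<Gamma> e = open_edge \<Gamma> e'"

definition orbit_space ::
    "('a, 'm) monoid_scheme \<Rightarrow> ('v, 'e) edge_data \<Rightarrow> ('a \<Rightarrow> ('v, 'e) point \<Rightarrow> ('v, 'e) point)
      \<Rightarrow> ('v, 'e) point set topology" where
  "orbit_space G \<Gamma> \<phi> = topology (\<lambda>U. U \<subseteq> orbits G (points \<Gamma>) \<phi> \<and>
     openin (cw_topology \<Gamma>) {x \<in> points \<Gamma>. orbit G \<phi> x \<in> U})"

lemma openin_orbit_space:
  "openin (orbit_space G \<Gamma> \<phi>) U \<longleftrightarrow> U \<subseteq> orbits G (points \<Gamma>) \<phi> \<and>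
     openin (cw_topology \<Gamma>) {x \<in> points \<Gamma>. orbit G \<phi> x \<in> U}"
proof -
  have "istopology (\<lambda>U. U \<subseteq> orbits G (points \<Gamma>) \<phi> \<and>
     openin (cw_topology \<Gamma>) {x \<in> points \<Gamma>. orbit G \<phi> x \<in> U})"
    unfolding istopology_def
  proof (intro conjI allI impI)
    fix S T
    assume "S \<subseteq> orbits G (points \<Gamma>) \<phi> \<and> openin (cw_topology \<Gamma>) {x \<in> points \<Gamma>. orbit G \<phi> x \<in> S}"
      and "T \<subseteq> orbits G (points \<Gamma>) \<phi> \<and> openin (cw_topology \<Gamma>) {x \<in> points \<Gamma>. orbit G \<phi> x \<in> T}"
    then have "openin (cw_topology \<Gamma>)
        ({x \<in> points \<Gamma>. orbit G \<phi> x \<in> S} \<inter> {x \<in> points \<Gamma>. orbit G \<phi> x \<in> T})"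
      by blast
    moreover have "{x \<in> points \<Gamma>. orbit G \<phi> x \<in> S} \<inter> {x \<in> points \<Gamma>. orbit G \<phi> x \<in> T}
        = {x \<in> points \<Gamma>. orbit G \<phi> x \<in> S \<inter> T}"
      by blast
    ultimately show "openin (cw_topology \<Gamma>) {x \<in> points \<Gamma>. orbit G \<phi> x \<in> S \<inter> T}"
      by simp
  next
    fix \<K>
    assume "\<forall>S \<in> \<K>. S \<subseteq> orbits G (points \<Gamma>) \<phi> \<and>
        openin (cw_topology \<Gamma>) {x \<in> points \<Gamma>. orbit G \<phi> x \<in> S}"
    then have "openin (cw_topology \<Gamma>) (\<Union>S \<in> \<K>. {x \<in> points \<Gamma>. orbit G \<phi> x \<in> S})"
      by blast
    moreover have "(\<Union>S \<in> \<K>. {x \<in> points \<Gamma>. orbit G \<phi> x \<in> S})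
        = {x \<in> points \<Gamma>. orbit G \<phi> x \<in> \<Union>\<K>}"
      by blast
    ultimately show "openin (cw_topology \<Gamma>) {x \<in> points \<Gamma>. orbit G \<phi> x \<in> \<Union>\<K>}"
      by simp
  qed blast+
  then show ?thesis
    unfolding orbit_space_def by (simp add: topology_inverse')
qed

definition cocompact ::
    "('a, 'm) monoid_scheme \<Rightarrow> ('v, 'e) edge_data \<Rightarrow> ('a \<Rightarrow> ('v, 'e) point \<Rightarrow> ('v, 'e) point)
      \<Rightarrow> bool" where
  "cocompact G \<Gamma> \<phi> \<longleftrightarrow> compact_space (orbit_space G \<Gamma> \<phi>)"

definition based_length ::
    "('v, 'e) edge_data \<Rightarrow> ('a \<Rightarrow> ('v, 'e) point \<Rightarrow> ('v, 'e) point) \<Rightarrow> ('v, 'e) point \<Rightarrow> 'a \<Rightarrow> real" where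
  "based_length \<Gamma> \<phi> p g = path_dist \<Gamma> p (\<phi> g p)"

end

theory Submission
  imports Defs "HOL-Algebra.Generated_Groups"
begin

text \<open>
  The theorem is a form of the Svarc-Milnor lemma. The first half follows from the second one as
  soon as a single locally compact, cocompact graph with a free orbit exists, and the Cayley graph
  of a finite generating set is one. By A5 every element outside some ball can be shortened by a
  definite amount by dividing it by an element of the ball (\<open>uniform_descent\<close>), so the ball, which
  is finite by A4, generates the group (\<open>generated_by_ball\<close>).

  For the second half let \<open>q\<close> be a point with trivial stabilizer in any such graph. The based length
  at \<open>q\<close> is subadditive and vanishes at the identity, and the descent in A5 shows that such a
  function is bounded by a multiple of \<open>l\<close> (\<open>subadditive_le_length\<close>).
  For the opposite bound (\<open>length_le_based_length\<close>) a path from \<open>q\<close> to its translate by \<open>g\<close>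
  is cut into short pieces. This needs that the orbit of \<open>q\<close> is cobounded, which is a
  direct consequence of cocompactness (\<open>orbit_is_cobounded\<close>), and that only finitely many elements
  have bounded based length (\<open>finite_based_length_ball\<close>).

  The latter is the geometric core. Local compactness of the weak topology forces every vertex to
  have finite valence (\<open>finite_star\<close>). Cocompactness leaves only finitely many orbits of edges
  (\<open>finite_edge_orbits\<close>), hence edge lengths bounded below. In such a graph a ball
  contains finitely many vertices (\<open>finite_vertex_ball\<close>). Finally the action preserves the distance
  to the nearest vertex (\<open>depth_act\<close>), so that an orbit meets each edge in at most two points, and
  a ball meets the orbit of \<open>q\<close> in a finite set.

  Path distances are infima over paths, so upper bounds come from exhibiting a path and lower
  bounds from functions that are Lipschitz on each closed edge (\<open>path_dist_Lipschitz\<close>).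
\<close>

section \<open>Piecewise linear paths and Lipschitz functions\<close>

text \<open>
  The combinatorial part of a metric graph. For Cayley graphs, connectedness and the separation of
  points are deduced from it.
\<close>

locale weighted_graph =
  fixes \<Gamma> :: "('v, 'e) edge_data"
  assumes origin_vertex: "e \<in> edges \<Gamma> \<Longrightarrow> origin \<Gamma> e \<in> verts \<Gamma>"
    and terminus_vertex: "e \<in> edges \<Gamma> \<Longrightarrow> terminus \<Gamma> e \<in> verts \<Gamma>"
    and len_positive: "e \<in> edges \<Gamma> \<Longrightarrow> 0 < len \<Gamma> e"
begin

lemma char_map_origin [simp]: "char_map \<Gamma> e 0 = Vertex (origin \<Gamma> e)"
  by (simp add: char_map_def)

lemma char_map_terminus: "e \<in> edges \<Gamma> \<Longrightarrow> char_map \<Gamma> e (len \<Gamma> e) = Vertex (terminus \<Gamma> e)"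
  using len_positive[of e] by (simp add: char_map_def)

lemma char_map_inner: "0 < t \<Longrightarrow> t < len \<Gamma> e \<Longrightarrow> char_map \<Gamma> e t = Inner e t"
  by (simp add: char_map_def)

lemma Vertex_in_points [simp]: "Vertex v \<in> points \<Gamma> \<longleftrightarrow> v \<in> verts \<Gamma>"
  by (auto simp: points_def open_edge_def)

lemma Inner_in_points [simp]: "Inner e t \<in> points \<Gamma> \<longleftrightarrow> e \<in> edges \<Gamma> \<and> 0 < t \<and> t < len \<Gamma> e"
  by (force simp: points_def open_edge_def)

lemma Inner_in_open_edge [simp]: "Inner e t \<in> open_edge \<Gamma> e' \<longleftrightarrow> e = e' \<and> 0 < t \<and> t < len \<Gamma> e"
  by (auto simp: open_edge_def)

lemma Vertex_notin_open_edge [simp]: "Vertex v \<notin> open_edge \<Gamma> e"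
  by (auto simp: open_edge_def)

lemma char_map_in_points: "e \<in> edges \<Gamma> \<Longrightarrow> char_map \<Gamma> e t \<in> points \<Gamma>"
  using origin_vertex[of e] terminus_vertex[of e] by (simp add: char_map_def)

lemma points_cases [consumes 1, case_names Vertex Inner]:
  assumes "x \<in> points \<Gamma>"
  obtains v where "x = Vertex v" "v \<in> verts \<Gamma>"
  | e t where "x = Inner e t" "e \<in> edges \<Gamma>" "0 < t" "t < len \<Gamma> e"
  using assms by (cases x) auto

lemma pl_path_ends:
  assumes "pl_path \<Gamma> x L y"
  shows "x \<in> points \<Gamma>" "y \<in> points \<Gamma>" "0 \<le> L"
  using assms by (induction rule: pl_path.induct) (auto simp: char_map_in_points)

lemma pl_path_edge:
  assumes "e \<in> edges \<Gamma>" "s \<in> {0..len \<Gamma> e}" "t \<in> {0..len \<Gamma> e}"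
  shows "pl_path \<Gamma> (char_map \<Gamma> e s) \<bar>t - s\<bar> (char_map \<Gamma> e t)"
  using pl_path.segment[OF pl_path.trivial[OF char_map_in_points] assms(1,2,3)] assms(1) by simp

lemma pl_path_trans:
  assumes "pl_path \<Gamma> y M z" "pl_path \<Gamma> x L y"
  shows "pl_path \<Gamma> x (L + M) z"
  using assms
proof (induction rule: pl_path.induct)
  case (segment y M e s t)
  then show ?case
    using pl_path.segment[of \<Gamma> x "L + M" e s t] by (simp add: add.assoc)
qed simp

lemma pl_path_sym: "pl_path \<Gamma> x L y \<Longrightarrow> pl_path \<Gamma> y L x"
proof (induction rule: pl_path.induct)
  case (segment x L e s t)
  then show ?case
    using pl_path_trans[OF segment.IH pl_path_edge[of e t s]] by (simp add: add.commute abs_minus_commute)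
qed (rule pl_path.trivial)

lemma pl_path_split:
  assumes "pl_path \<Gamma> x L y" "0 \<le> a" "a \<le> L"
  shows "\<exists>z. pl_path \<Gamma> x a z \<and> pl_path \<Gamma> z (L - a) y"
  using assms
proof (induction arbitrary: a rule: pl_path.induct)
  case (trivial x)
  then show ?case
    using pl_path.trivial[of x \<Gamma>] by auto
next
  case (segment x L e s t)
  show ?case
  proof (cases "a \<le> L")
    case True
    then obtain z where z: "pl_path \<Gamma> x a z" "pl_path \<Gamma> z (L - a) (char_map \<Gamma> e s)"
      using segment by blast
    from pl_path.segment[OF z(2) segment.hyps(2-4)] z(1) show ?thesis
      by (auto simp: algebra_simps)
  next
    case False
    \<comment> \<open>The point at distance \<open>a - L\<close> from \<open>s\<close> in the direction of \<open>t\<close>.\<close>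
    define r where "r = (if s \<le> t then s + (a - L) else s - (a - L))"
    have r: "r \<in> {0..len \<Gamma> e}" "\<bar>r - s\<bar> = a - L" "\<bar>t - r\<bar> = L + \<bar>t - s\<bar> - a"
      using False segment.prems segment.hyps(3,4) by (auto simp: r_def split: if_splits)
    show ?thesis
      using pl_path.segment[OF segment.hyps(1-3) r(1)] pl_path_edge[OF segment.hyps(2) r(1) segment.hyps(4)]
      by (intro exI[of _ "char_map \<Gamma> e r"]) (simp add: r)
  qed
qed

text \<open>
  A Lipschitz condition that refers only to the characteristic maps of the closed edges. It can be
  checked one edge at a time, without any knowledge of the path distance.
\<close>

definition edgewise_Lipschitz :: "real \<Rightarrow> (('v, 'e) point \<Rightarrow> real) \<Rightarrow> bool" where
  "edgewise_Lipschitz C F \<longleftrightarrow> 0 \<le> C \<and>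
     (\<forall>e \<in> edges \<Gamma>. \<forall>s \<in> {0..len \<Gamma> e}. \<forall>t \<in> {0..len \<Gamma> e}.
        \<bar>F (char_map \<Gamma> e t) - F (char_map \<Gamma> e s)\<bar> \<le> C * \<bar>t - s\<bar>)"

lemma edgewise_LipschitzI:
  assumes "0 \<le> C"
    and "\<And>e s t. e \<in> edges \<Gamma> \<Longrightarrow> 0 \<le> s \<Longrightarrow> s \<le> t \<Longrightarrow> t \<le> len \<Gamma> e \<Longrightarrow>
      \<bar>F (char_map \<Gamma> e t) - F (char_map \<Gamma> e s)\<bar> \<le> C * (t - s)"
  shows "edgewise_Lipschitz C F"
  unfolding edgewise_Lipschitz_def
proof (intro conjI ballI)
  fix e s t
  assume "e \<in> edges \<Gamma>" "s \<in> {0..len \<Gamma> e}" "t \<in> {0..len \<Gamma> e}"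
  then show "\<bar>F (char_map \<Gamma> e t) - F (char_map \<Gamma> e s)\<bar> \<le> C * \<bar>t - s\<bar>"
    using assms(2)[of e s t] assms(2)[of e t s]
    by (cases "s \<le> t") (simp_all add: abs_minus_commute)
qed fact

lemma pl_path_Lipschitz:
  assumes "edgewise_Lipschitz C F" "pl_path \<Gamma> x L y"
  shows "\<bar>F y - F x\<bar> \<le> C * L"
  using assms(2)
proof (induction rule: pl_path.induct)
  case (segment x L e s t)
  have "\<bar>F (char_map \<Gamma> e t) - F (char_map \<Gamma> e s)\<bar> \<le> C * \<bar>t - s\<bar>"
    using assms(1) segment.hyps unfolding edgewise_Lipschitz_def by blast
  then show ?case
    using segment.IH by (simp add: distrib_left)
qed simp

lemma bdd_below_path_lengths: "bdd_below {L. pl_path \<Gamma> x L y}"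
  using pl_path_ends(3) by (intro bdd_belowI[of _ 0]) simp

lemma path_dist_le: "pl_path \<Gamma> x L y \<Longrightarrow> path_dist \<Gamma> x y \<le> L"
  using pl_path_ends[of x L y] by (simp add: path_dist_def cInf_lower bdd_below_path_lengths)

lemma path_dist_edge:
  assumes "e \<in> edges \<Gamma>" "s \<in> {0..len \<Gamma> e}" "t \<in> {0..len \<Gamma> e}"
  shows "path_dist \<Gamma> (char_map \<Gamma> e s) (char_map \<Gamma> e t) \<le> \<bar>t - s\<bar>"
  using path_dist_le pl_path_edge assms by blast

lemma path_dist_sym: "path_dist \<Gamma> x y = path_dist \<Gamma> y x"
proof -
  have "{L. pl_path \<Gamma> x L y} = {L. pl_path \<Gamma> y L x}"
    using pl_path_sym by blast
  then show ?thesis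
    by (simp add: path_dist_def)
qed

text \<open>
  A function on the vertices with controlled differences along edges becomes a function on the
  graph to which \<open>pl_path_Lipschitz\<close> applies; this bounds distances between vertices from below.
\<close>

definition linear_extension :: "('v \<Rightarrow> real) \<Rightarrow> ('v, 'e) point \<Rightarrow> real" where
  "linear_extension h x = (case x of Vertex v \<Rightarrow> h v
     | Inner e t \<Rightarrow> h (origin \<Gamma> e) + t * ((h (terminus \<Gamma> e) - h (origin \<Gamma> e)) / len \<Gamma> e))"

lemma edgewise_Lipschitz_linear_extension:
  assumes "0 \<le> C"
    and "\<And>e. e \<in> edges \<Gamma> \<Longrightarrow> \<bar>h (terminus \<Gamma> e) - h (origin \<Gamma> e)\<bar> \<le> C * len \<Gamma> e"
  shows "edgewise_Lipschitz C (linear_extension h)"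
proof (rule edgewise_LipschitzI)
  fix e s t
  assume e: "e \<in> edges \<Gamma>" and st: "0 \<le> s" "s \<le> t" "t \<le> len \<Gamma> e"
  define m where "m = (h (terminus \<Gamma> e) - h (origin \<Gamma> e)) / len \<Gamma> e"
  have m: "\<bar>m\<bar> \<le> C"
    using assms(2)[OF e] len_positive[OF e] by (simp add: m_def divide_le_eq)
  have "linear_extension h (char_map \<Gamma> e r) = h (origin \<Gamma> e) + r * m" if "0 \<le> r" "r \<le> len \<Gamma> e" for r
    using that len_positive[OF e] by (simp add: linear_extension_def char_map_def m_def)
  then have "linear_extension h (char_map \<Gamma> e t) - linear_extension h (char_map \<Gamma> e s) = m * (t - s)"
    using st by (simp add: algebra_simps)
  then show "\<bar>linear_extension h (char_map \<Gamma> e t) - linear_extension h (char_map \<Gamma> e s)\<bar> \<le> C * (t - s)"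
    using m st by (simp add: abs_mult mult_right_mono)
qed fact

text \<open>The path distance to the nearest vertex, in closed form.\<close>

definition depth :: "('v, 'e) point \<Rightarrow> real" where
  "depth x = (case x of Vertex v \<Rightarrow> 0 | Inner e t \<Rightarrow> min t (len \<Gamma> e - t))"

lemma depth_Vertex [simp]: "depth (Vertex v) = 0"
  and depth_Inner [simp]: "depth (Inner e t) = min t (len \<Gamma> e - t)"
  by (simp_all add: depth_def)

lemma edgewise_Lipschitz_depth: "edgewise_Lipschitz 1 depth"
proof (rule edgewise_LipschitzI)
  fix e s t
  assume e: "e \<in> edges \<Gamma>" and st: "0 \<le> s" "s \<le> t" "t \<le> len \<Gamma> e"
  have "depth (char_map \<Gamma> e r) = min r (len \<Gamma> e - r)" if "0 \<le> r" "r \<le> len \<Gamma> e" for r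
    using that by (simp add: depth_def char_map_def)
  then show "\<bar>depth (char_map \<Gamma> e t) - depth (char_map \<Gamma> e s)\<bar> \<le> 1 * (t - s)"
    using st by (auto simp: min_def)
qed simp

definition star :: "'v \<Rightarrow> 'e set" where
  "star v = {e \<in> edges \<Gamma>. origin \<Gamma> e = v \<or> terminus \<Gamma> e = v}"

lemma nearest_vertex:
  assumes "x \<in> points \<Gamma>"
  shows "\<exists>v \<in> verts \<Gamma>. pl_path \<Gamma> x (depth x) (Vertex v) \<and>
    x \<in> insert (Vertex v) (\<Union>e \<in> star v. {Inner e (depth x), Inner e (len \<Gamma> e - depth x)})"
  using assms
proof (cases x rule: points_cases)
  case (Vertex v)
  then show ?thesis
    using pl_path.trivial[of "Vertex v" \<Gamma>] by auto
next
  case (Inner e t)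
  have t: "t \<in> {0..len \<Gamma> e}" "0 \<in> {0..len \<Gamma> e}" "len \<Gamma> e \<in> {0..len \<Gamma> e}"
    using Inner by auto
  show ?thesis
  proof (cases "t \<le> len \<Gamma> e - t")
    case True
    then show ?thesis
      using pl_path_edge[OF Inner(2) t(1,2)] Inner origin_vertex[of e]
      by (intro bexI[of _ "origin \<Gamma> e"]) (auto simp: char_map_inner star_def min_def)
  next
    case False
    then show ?thesis
      using pl_path_edge[OF Inner(2) t(1,3)] Inner terminus_vertex[of e]
      by (intro bexI[of _ "terminus \<Gamma> e"]) (auto simp: char_map_inner char_map_terminus star_def min_def)
  qed
qed

text \<open>
  A tent function around an inner point; it vanishes at the ends of the edge, so that it is still
  Lipschitz when set to zero on the rest of the graph. It attains its maximum at one point only,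
  and hence separates this point from all others.
\<close>

definition tent :: "'e \<Rightarrow> real \<Rightarrow> ('v, 'e) point \<Rightarrow> real" where
  "tent e a x = (case x of Vertex v \<Rightarrow> 0
     | Inner e' t \<Rightarrow> if e' = e then max 0 (min a (len \<Gamma> e - a) - \<bar>t - a\<bar>) else 0)"

lemma edgewise_Lipschitz_tent:
  "edgewise_Lipschitz 1 (tent e a)"
proof (rule edgewise_LipschitzI)
  fix e' s t
  assume e: "e' \<in> edges \<Gamma>" and st: "0 \<le> s" "s \<le> t" "t \<le> len \<Gamma> e'"
  have "tent e a (char_map \<Gamma> e' r)
      = (if e' = e then max 0 (min a (len \<Gamma> e - a) - \<bar>r - a\<bar>) else 0)"
    if "0 \<le> r" "r \<le> len \<Gamma> e'" for r
    using that by (auto simp: tent_def char_map_def max_def min_def)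
  then show "\<bar>tent e a (char_map \<Gamma> e' t) - tent e a (char_map \<Gamma> e' s)\<bar> \<le> 1 * (t - s)"
    using st by (auto simp: max_def abs_if)
qed simp

end

locale path_connected_graph = weighted_graph \<Gamma> for \<Gamma> :: "('v, 'e) edge_data" +
  assumes path_exists: "x \<in> points \<Gamma> \<Longrightarrow> y \<in> points \<Gamma> \<Longrightarrow> \<exists>L. pl_path \<Gamma> x L y"
begin

lemma path_dist_approx:
  assumes "x \<in> points \<Gamma>" "y \<in> points \<Gamma>" "0 < \<delta>"
  shows "\<exists>L < path_dist \<Gamma> x y + \<delta>. pl_path \<Gamma> x L y"
  using cInf_lessD[of "{L. pl_path \<Gamma> x L y}" "path_dist \<Gamma> x y + \<delta>"] path_exists[of x y] assms
  by (auto simp: path_dist_def)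

lemma path_dist_nonneg: "0 \<le> path_dist \<Gamma> x y"
  using path_exists[of x y] pl_path_ends(3)
  by (auto simp: path_dist_def intro!: cInf_greatest)

lemma path_dist_triangle:
  assumes "x \<in> points \<Gamma>" "y \<in> points \<Gamma>" "z \<in> points \<Gamma>"
  shows "path_dist \<Gamma> x z \<le> path_dist \<Gamma> x y + path_dist \<Gamma> y z"
proof (rule field_le_epsilon)
  fix \<delta> :: real
  assume "0 < \<delta>"
  then obtain L M where "L < path_dist \<Gamma> x y + \<delta> / 2" "pl_path \<Gamma> x L y"
      "M < path_dist \<Gamma> y z + \<delta> / 2" "pl_path \<Gamma> y M z"
    using path_dist_approx[of _ _ "\<delta> / 2"] assms by (metis half_gt_zero)
  then show "path_dist \<Gamma> x z \<le> path_dist \<Gamma> x y + path_dist \<Gamma> y z + \<delta>"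
    using path_dist_le[OF pl_path_trans] by fastforce
qed

lemma path_dist_Lipschitz:
  assumes "edgewise_Lipschitz C F" "x \<in> points \<Gamma>" "y \<in> points \<Gamma>"
  shows "\<bar>F y - F x\<bar> \<le> C * path_dist \<Gamma> x y"
proof (rule field_le_epsilon)
  fix \<delta> :: real
  assume \<delta>: "0 < \<delta>"
  have C: "0 \<le> C"
    using assms(1) by (simp add: edgewise_Lipschitz_def)
  have "0 < \<delta> / (C + 1)"
    using \<delta> C by simp
  then obtain L where L: "L < path_dist \<Gamma> x y + \<delta> / (C + 1)" "pl_path \<Gamma> x L y"
    using path_dist_approx assms(2,3) by blast
  have "\<bar>F y - F x\<bar> \<le> C * L"
    by (rule pl_path_Lipschitz[OF assms(1) L(2)])
  also have "\<dots> \<le> C * (path_dist \<Gamma> x y + \<delta> / (C + 1))"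
    using L C by (intro mult_left_mono) auto
  also have "\<dots> \<le> C * path_dist \<Gamma> x y + \<delta>"
    using C \<delta> by (simp add: field_simps)
  finally show "\<bar>F y - F x\<bar> \<le> C * path_dist \<Gamma> x y + \<delta>" .
qed

lemma path_dist_separates_inner:
  assumes "x \<in> points \<Gamma>" "Inner e a \<in> points \<Gamma>" "path_dist \<Gamma> (Inner e a) x = 0"
  shows "x = Inner e a"
proof -
  have "tent e a x = tent e a (Inner e a)"
    using path_dist_Lipschitz[OF edgewise_Lipschitz_tent assms(2,1), of e a] assms(3) by simp
  then show ?thesis
    using assms(1,2) by (cases x) (auto simp: tent_def max_def split: if_splits)
qed

text \<open>
  Inner points are separated from all others by tent functions. For two vertices a uniform lower
  bound on the edge lengths is used: the function that is \<open>0\<close> at one vertex and \<open>\<delta>\<close> at all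
  others is then Lipschitz with constant one.
\<close>

lemma Metric_space_path_dist:
  assumes "0 < \<delta>" "\<And>e. e \<in> edges \<Gamma> \<Longrightarrow> \<delta> \<le> len \<Gamma> e"
  shows "Metric_space (points \<Gamma>) (path_dist \<Gamma>)"
proof
  fix x y
  assume x: "x \<in> points \<Gamma>" and y: "y \<in> points \<Gamma>"
  show "path_dist \<Gamma> x y = 0 \<longleftrightarrow> x = y"
  proof
    assume "x = y"
    then show "path_dist \<Gamma> x y = 0"
      using path_dist_le[OF pl_path.trivial[OF x]] path_dist_nonneg[of x x] by simp
  next
    assume 0: "path_dist \<Gamma> x y = 0"
    show "x = y"
    proof (cases x)
      case (Inner e t)
      then show ?thesis
        using path_dist_separates_inner[of y e t] x y 0 by simp
    next
      case X: (Vertex v)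
      show ?thesis
      proof (cases y)
        case (Inner e t)
        then show ?thesis
          using path_dist_separates_inner[of x e t] x y 0 by (simp add: path_dist_sym)
      next
        case (Vertex w)
        let ?h = "\<lambda>u. if u = v then 0 else \<delta>"
        have "edgewise_Lipschitz 1 (linear_extension ?h)"
          using assms len_positive by (intro edgewise_Lipschitz_linear_extension) fastforce+
        from path_dist_Lipschitz[OF this x y] have "?h w = ?h v"
          using 0 X Vertex by (simp add: linear_extension_def)
        then show ?thesis
          using assms(1) X Vertex by (auto split: if_splits)
      qed
    qed
  qed
qed (use path_dist_nonneg path_dist_sym path_dist_triangle in auto)

end

section \<open>The topology of a graph\<close>

context weighted_graph
begin

lemma topspace_cw_topology [simp]: "topspace (cw_topology \<Gamma>) = points \<Gamma>"
proof
  show "topspace (cw_topology \<Gamma>) \<subseteq> points \<Gamma>"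
    using openin_topspace[of "cw_topology \<Gamma>"] by (simp only: openin_cw_topology)
  have "{t \<in> {0..len \<Gamma> e}. char_map \<Gamma> e t \<in> points \<Gamma>} = {0..len \<Gamma> e}" if "e \<in> edges \<Gamma>" for e
    using that char_map_in_points by blast
  then have "openin (cw_topology \<Gamma>) (points \<Gamma>)"
    by (simp add: openin_cw_topology)
  then show "points \<Gamma> \<subseteq> topspace (cw_topology \<Gamma>)"
    by (rule openin_subset)
qed

lemma continuous_map_char_map:
  "e \<in> edges \<Gamma> \<Longrightarrow> continuous_map (top_of_set {0..len \<Gamma> e}) (cw_topology \<Gamma>) (char_map \<Gamma> e)"
  by (auto simp: continuous_map char_map_in_points openin_cw_topology)

lemma compactin_closed_edge:
  "e \<in> edges \<Gamma> \<Longrightarrow> compactin (cw_topology \<Gamma>) (char_map \<Gamma> e ` {0..len \<Gamma> e})"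
  by (rule image_compactin[OF _ continuous_map_char_map]) (simp_all add: compactin_subtopology)

lemma openin_cofinite_preimages:
  assumes "U \<subseteq> points \<Gamma>"
    and "\<And>e. e \<in> edges \<Gamma> \<Longrightarrow> finite {t \<in> {0..len \<Gamma> e}. char_map \<Gamma> e t \<notin> U}"
  shows "openin (cw_topology \<Gamma>) U"
  unfolding openin_cw_topology
proof (intro conjI ballI)
  fix e
  assume "e \<in> edges \<Gamma>"
  then have "open (- {t \<in> {0..len \<Gamma> e}. char_map \<Gamma> e t \<notin> U})"
    using assms(2) by (intro open_Compl finite_imp_closed) blast
  moreover have "{t \<in> {0..len \<Gamma> e}. char_map \<Gamma> e t \<in> U}
      = {0..len \<Gamma> e} \<inter> - {t \<in> {0..len \<Gamma> e}. char_map \<Gamma> e t \<notin> U}"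
    by blast
  ultimately show "openin (top_of_set {0..len \<Gamma> e}) {t \<in> {0..len \<Gamma> e}. char_map \<Gamma> e t \<in> U}"
    by (simp add: openin_open_Int)
qed fact

lemma openin_open_edge:
  assumes "e \<in> edges \<Gamma>"
  shows "openin (cw_topology \<Gamma>) (open_edge \<Gamma> e)"
  unfolding openin_cw_topology
proof (intro conjI ballI)
  show "open_edge \<Gamma> e \<subseteq> points \<Gamma>"
    using assms by (auto simp: points_def)
  fix e'
  assume "e' \<in> edges \<Gamma>"
  have "{t \<in> {0..len \<Gamma> e'}. char_map \<Gamma> e' t \<in> open_edge \<Gamma> e}
      = (if e' = e then {0..len \<Gamma> e'} \<inter> {0<..<len \<Gamma> e} else {})"
    by (auto simp: char_map_def)
  then show "openin (top_of_set {0..len \<Gamma> e'}) {t \<in> {0..len \<Gamma> e'}. char_map \<Gamma> e' t \<in> open_edge \<Gamma> e}"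
    by (simp add: openin_open_Int)
qed

lemma openin_edgewise_Lipschitz:
  assumes "edgewise_Lipschitz C F"
  shows "openin (cw_topology \<Gamma>) {x \<in> points \<Gamma>. F x < r}"
  unfolding openin_cw_topology
proof (intro conjI ballI)
  fix e
  assume e: "e \<in> edges \<Gamma>"
  have "C-lipschitz_on {0..len \<Gamma> e} (\<lambda>t. F (char_map \<Gamma> e t))"
    using assms e unfolding edgewise_Lipschitz_def lipschitz_on_def
    by (auto simp: dist_real_def abs_minus_commute)
  then have "continuous_on {0..len \<Gamma> e} (\<lambda>t. F (char_map \<Gamma> e t))"
    by (rule lipschitz_on_continuous_on)
  then have "openin (top_of_set {0..len \<Gamma> e}) ({0..len \<Gamma> e} \<inter> (\<lambda>t. F (char_map \<Gamma> e t)) -` {..<r})"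
    by (rule continuous_openin_preimage_gen) simp
  moreover have "{t \<in> {0..len \<Gamma> e}. char_map \<Gamma> e t \<in> {x \<in> points \<Gamma>. F x < r}}
      = {0..len \<Gamma> e} \<inter> (\<lambda>t. F (char_map \<Gamma> e t)) -` {..<r}"
    using char_map_in_points[OF e] by auto
  ultimately show "openin (top_of_set {0..len \<Gamma> e})
      {t \<in> {0..len \<Gamma> e}. char_map \<Gamma> e t \<in> {x \<in> points \<Gamma>. F x < r}}"
    by simp
qed auto

text \<open>
  A closed edge cannot leave a set that is open and closed, so neither can a path; conversely, the
  set of points that are reachable from a given one contains each closed edge that it meets.
\<close>

lemma pl_path_clopen:
  assumes "pl_path \<Gamma> x L y" "x \<in> T" "openin (cw_topology \<Gamma>) T" "closedin (cw_topology \<Gamma>) T"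
  shows "y \<in> T"
  using assms(1,2)
proof (induction rule: pl_path.induct)
  case (segment x L e s t)
  let ?S = "{r \<in> {0..len \<Gamma> e}. char_map \<Gamma> e r \<in> T}"
  note cont = continuous_map_char_map[OF segment.hyps(2)]
  have "openin (top_of_set {0..len \<Gamma> e}) ?S"
    using openin_continuous_map_preimage[OF cont assms(3)] by simp
  moreover have "closedin (top_of_set {0..len \<Gamma> e}) ?S"
    using closedin_continuous_map_preimage[OF cont assms(4)] by simp
  moreover have "s \<in> ?S"
    using segment.IH[OF segment.prems] segment.hyps by blast
  moreover have "connected {0..len \<Gamma> e}"
    by simp
  ultimately have "?S = {0..len \<Gamma> e}"
    unfolding connected_clopen by blast
  then show ?case
    using segment.hyps(4) by blast
qed

lemma connected_space_iff_path_connected: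
  "connected_space (cw_topology \<Gamma>) \<longleftrightarrow> path_connected_graph \<Gamma>"
proof
  assume conn: "connected_space (cw_topology \<Gamma>)"
  show "path_connected_graph \<Gamma>"
  proof unfold_locales
    fix x y
    assume x: "x \<in> points \<Gamma>" and y: "y \<in> points \<Gamma>"
    define T where "T = {z. \<exists>L. pl_path \<Gamma> x L z}"
    have T: "T \<subseteq> points \<Gamma>"
      unfolding T_def using pl_path_ends(2) by blast
    have all: "char_map \<Gamma> e t \<in> T \<longleftrightarrow> char_map \<Gamma> e s \<in> T"
      if "e \<in> edges \<Gamma>" "s \<in> {0..len \<Gamma> e}" "t \<in> {0..len \<Gamma> e}" for e s t
      unfolding T_def using that pl_path.segment[of \<Gamma> x] by blast
    have "openin (top_of_set {0..len \<Gamma> e}) {t \<in> {0..len \<Gamma> e}. char_map \<Gamma> e t \<in> U}"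
      if e: "e \<in> edges \<Gamma>" and U: "U = T \<or> U = points \<Gamma> - T" for e U
    proof -
      have "{t \<in> {0..len \<Gamma> e}. char_map \<Gamma> e t \<in> U} = {}
          \<or> {t \<in> {0..len \<Gamma> e}. char_map \<Gamma> e t \<in> U} = {0..len \<Gamma> e}"
        using all[OF e] U char_map_in_points[OF e] by blast
      then show ?thesis
        by (elim disjE) (simp_all only: openin_empty openin_subtopology_self)
    qed
    then have "openin (cw_topology \<Gamma>) U" if "U = T \<or> U = points \<Gamma> - T" for U
      using T that unfolding openin_cw_topology by blast
    then have "openin (cw_topology \<Gamma>) T" "closedin (cw_topology \<Gamma>) T"
      using T by (simp_all add: closedin_def)
    moreover have "x \<in> T"
      using x pl_path.trivial T_def by blast
    ultimately have "T = points \<Gamma>"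
      using conn unfolding connected_space_clopen_in by fastforce
    then show "\<exists>L. pl_path \<Gamma> x L y"
      using y T_def by blast
  qed
next
  assume "path_connected_graph \<Gamma>"
  then interpret path_connected_graph \<Gamma> .
  show "connected_space (cw_topology \<Gamma>)"
    unfolding connected_space_clopen_in
  proof (intro allI impI)
    fix T
    assume T: "openin (cw_topology \<Gamma>) T \<and> closedin (cw_topology \<Gamma>) T"
    then have "T \<subseteq> points \<Gamma>"
      using openin_subset by fastforce
    moreover have "points \<Gamma> \<subseteq> T" if "T \<noteq> {}"
      using that T path_exists pl_path_clopen calculation by (metis ex_in_conv subset_iff)
    ultimately show "T = {} \<or> T = topspace (cw_topology \<Gamma>)"
      by auto
  qed
qed

lemma locally_compact_if_finite_stars:
  assumes fin: "\<And>v. v \<in> verts \<Gamma> \<Longrightarrow> finite (star v)"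
  shows "locally_compact_space (cw_topology \<Gamma>)"
  unfolding locally_compact_space_def topspace_cw_topology
proof
  fix x
  assume "x \<in> points \<Gamma>"
  then show "\<exists>U K. openin (cw_topology \<Gamma>) U \<and> compactin (cw_topology \<Gamma>) K \<and> x \<in> U \<and> U \<subseteq> K"
  proof (cases x rule: points_cases)
    case (Inner e t)
    have "open_edge \<Gamma> e \<subseteq> char_map \<Gamma> e ` {0..len \<Gamma> e}"
      by (auto simp: open_edge_def char_map_def intro!: image_eqI)
    then show ?thesis
      using Inner openin_open_edge[of e] compactin_closed_edge[of e]
      by (intro exI[of _ "open_edge \<Gamma> e"] exI[of _ "char_map \<Gamma> e ` {0..len \<Gamma> e}"]) auto
  next
    case (Vertex v)
    let ?U = "insert x (\<Union>e \<in> star v. open_edge \<Gamma> e)"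
    let ?K = "insert x (\<Union>e \<in> star v. char_map \<Gamma> e ` {0..len \<Gamma> e})"
    have "compactin (cw_topology \<Gamma>) ?K"
      using fin[OF Vertex(2)] Vertex compactin_closed_edge
      by (subst insert_is_Un, intro compactin_Un compactin_Union) (auto simp: star_def)
    moreover have "?U \<subseteq> ?K"
      by (force simp: open_edge_def char_map_def intro!: image_eqI)
    moreover have "openin (cw_topology \<Gamma>) ?U"
      unfolding openin_cw_topology
    proof (intro conjI ballI)
      show "?U \<subseteq> points \<Gamma>"
        using Vertex by (auto simp: points_def star_def)
      fix e
      assume e: "e \<in> edges \<Gamma>"
      \<comment> \<open>The closed subset of \<open>{0..len \<Gamma> e}\<close> that has to be removed: the ends that are not at \<open>v\<close>.\<close>
      let ?D = "(if origin \<Gamma> e = v then {} else {0}) \<union> (if terminus \<Gamma> e = v then {} else {len \<Gamma> e})"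
      have "{t \<in> {0..len \<Gamma> e}. char_map \<Gamma> e t \<in> ?U} = (if e \<in> star v then {0..len \<Gamma> e} \<inter> - ?D else {})"
        using e len_positive[OF e] Vertex by (auto simp: char_map_def star_def split: if_splits)
      moreover have "open (- ?D)"
        by (intro open_Compl finite_imp_closed) simp
      ultimately show "openin (top_of_set {0..len \<Gamma> e}) {t \<in> {0..len \<Gamma> e}. char_map \<Gamma> e t \<in> ?U}"
        by (simp only: openin_open_Int openin_empty split: if_split) simp
    qed
    ultimately show ?thesis
      by blast
  qed
qed

text \<open>
  Conversely, pick a point near \<open>v\<close> on every edge at \<open>v\<close>. These points form a discrete closed set
  in the weak topology, and inside a compact neighbourhood of \<open>v\<close> such a set is finite.
\<close>

lemma finite_star:
  assumes lc: "locally_compact_space (cw_topology \<Gamma>)" and v: "v \<in> verts \<Gamma>"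
  shows "finite (star v)"
proof -
  obtain U K where U: "openin (cw_topology \<Gamma>) U" and K: "compactin (cw_topology \<Gamma>) K"
    and vUK: "Vertex v \<in> U" "U \<subseteq> K"
    using lc v unfolding locally_compact_space_def topspace_cw_topology by (meson Vertex_in_points)
  have "\<exists>t. 0 < t \<and> t < len \<Gamma> e \<and> Inner e t \<in> U" if e: "e \<in> star v" for e
  proof -
    let ?n = "len \<Gamma> e"
    have e': "e \<in> edges \<Gamma>" and n: "0 < ?n"
      using e len_positive by (auto simp: star_def)
    have "openin (top_of_set {0..?n}) {t \<in> {0..?n}. char_map \<Gamma> e t \<in> U}"
      using U e' by (simp add: openin_cw_topology)
    then obtain S where S: "open S" "{t \<in> {0..?n}. char_map \<Gamma> e t \<in> U} = {0..?n} \<inter> S"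
      by (auto simp: openin_open)
    obtain r where r: "r = 0 \<or> r = ?n" "char_map \<Gamma> e r \<in> U"
      using e vUK(1) char_map_terminus[OF e'] by (force simp: star_def)
    have "r \<in> {t \<in> {0..?n}. char_map \<Gamma> e t \<in> U}"
      using r n by auto
    then have "r \<in> S"
      unfolding S(2) by blast
    then obtain \<delta> where \<delta>: "0 < \<delta>" "ball r \<delta> \<subseteq> S"
      using S(1) open_contains_ball by blast
    define d where "d = min (\<delta> / 2) (?n / 2)"
    define t where "t = (if r = 0 then d else ?n - d)"
    have d: "0 < d" "d < \<delta>" "d < ?n"
      using \<delta> n by (auto simp: d_def min_def)
    have t: "0 < t" "t < ?n"
      using d by (auto simp: t_def)
    have "t \<in> ball r \<delta>"
      using d r(1) by (auto simp: t_def dist_real_def)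
    then have "t \<in> {0..?n} \<inter> S"
      using \<delta>(2) t by auto
    then have "char_map \<Gamma> e t \<in> U"
      unfolding S(2)[symmetric] by blast
    then show ?thesis
      using t char_map_inner by auto
  qed
  then obtain \<tau> where \<tau>: "\<And>e. e \<in> star v \<Longrightarrow> 0 < \<tau> e \<and> \<tau> e < len \<Gamma> e \<and> Inner e (\<tau> e) \<in> U"
    by metis
  define A where "A = (\<lambda>e. Inner e (\<tau> e) :: ('v, 'e) point) ` star v"
  have "openin (cw_topology \<Gamma>) (points \<Gamma> - A)"
  proof (rule openin_cofinite_preimages)
    fix e
    assume "e \<in> edges \<Gamma>"
    then have "{t \<in> {0..len \<Gamma> e}. char_map \<Gamma> e t \<notin> points \<Gamma> - A} \<subseteq> {\<tau> e}"
      using char_map_in_points by (auto simp: A_def char_map_def split: if_splits)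
    then show "finite {t \<in> {0..len \<Gamma> e}. char_map \<Gamma> e t \<notin> points \<Gamma> - A}"
      by (rule finite_subset) simp
  qed auto
  then have open_cover: "\<forall>V \<in> insert (points \<Gamma> - A) (open_edge \<Gamma> ` star v). openin (cw_topology \<Gamma>) V"
    using openin_open_edge by (auto simp: star_def)
  have "A \<subseteq> \<Union>(open_edge \<Gamma> ` star v)"
    using \<tau> by (auto simp: A_def)
  then have "K \<subseteq> \<Union>(insert (points \<Gamma> - A) (open_edge \<Gamma> ` star v))"
    using compactin_subset_topspace[OF K] by auto
  with K open_cover obtain \<F> where \<F>: "finite \<F>" "\<F> \<subseteq> insert (points \<Gamma> - A) (open_edge \<Gamma> ` star v)"
      "K \<subseteq> \<Union>\<F>"
    unfolding compactin_def by meson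
  have "finite (\<F> - {points \<Gamma> - A})" "\<F> - {points \<Gamma> - A} \<subseteq> open_edge \<Gamma> ` star v"
    using \<F> by auto
  then obtain E where E: "finite E" "\<F> - {points \<Gamma> - A} = open_edge \<Gamma> ` E"
    by (meson finite_subset_image)
  have "star v \<subseteq> E"
  proof
    fix e
    assume e: "e \<in> star v"
    have "Inner e (\<tau> e) \<in> \<Union>\<F>"
      using \<tau>[OF e] vUK(2) \<F>(3) by blast
    moreover have "Inner e (\<tau> e) \<in> A"
      using e by (simp add: A_def)
    ultimately obtain V where "V \<in> \<F> - {points \<Gamma> - A}" "Inner e (\<tau> e) \<in> V"
      by blast
    then obtain e' where "e' \<in> E" "Inner e (\<tau> e) \<in> open_edge \<Gamma> e'"
      unfolding E(2) by blast
    then show "e \<in> E"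
      by simp
  qed
  then show ?thesis
    using E(1) finite_subset by blast
qed

end

section \<open>Balls in locally finite graphs\<close>

context path_connected_graph
begin

primrec edge_ball :: "'v \<Rightarrow> nat \<Rightarrow> 'v set" where
  "edge_ball u 0 = {u}"
| "edge_ball u (Suc n)
     = edge_ball u n \<union> (\<Union>w \<in> edge_ball u n. \<Union>e \<in> star w. {origin \<Gamma> e, terminus \<Gamma> e})"

lemma centre_in_edge_ball: "u \<in> edge_ball u n"
  by (induction n) simp_all

lemma finite_edge_ball:
  assumes "\<And>v. v \<in> verts \<Gamma> \<Longrightarrow> finite (star v)" "u \<in> verts \<Gamma>"
  shows "finite (edge_ball u n) \<and> edge_ball u n \<subseteq> verts \<Gamma>"
proof (induction n)
  case (Suc n)
  have "edge_ball u (Suc n) \<subseteq> verts \<Gamma>"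
    using Suc origin_vertex terminus_vertex by (auto simp: star_def)
  then show ?case
    using Suc assms(1) by auto
qed (simp add: assms(2))

text \<open>
  If all edges have length at least \<open>\<delta>\<close>, then a vertex that is not reached by crossing fewer than
  \<open>n\<close> edges has distance at least \<open>n * \<delta>\<close>: the number of combinatorial balls missing a vertex
  changes by at most one along an edge.
\<close>

lemma finite_vertex_ball:
  assumes fin: "\<And>v. v \<in> verts \<Gamma> \<Longrightarrow> finite (star v)"
    and \<delta>: "0 < \<delta>" "\<And>e. e \<in> edges \<Gamma> \<Longrightarrow> \<delta> \<le> len \<Gamma> e"
    and u: "u \<in> verts \<Gamma>"
  shows "finite {v \<in> verts \<Gamma>. path_dist \<Gamma> (Vertex u) (Vertex v) \<le> R}"
proof -
  obtain n where n: "R < real n * \<delta>"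
    using reals_Archimedean3[OF \<delta>(1)] by blast
  define missed where "missed v = {j. j < n \<and> v \<notin> edge_ball u j}" for v
  define h where "h v = \<delta> * real (card (missed v))" for v
  have step: "card (missed w) \<le> card (missed v) + 1"
    if "e \<in> edges \<Gamma>" "{v, w} = {origin \<Gamma> e, terminus \<Gamma> e}" for e v w
  proof -
    have ev: "e \<in> star v" "w \<in> {origin \<Gamma> e, terminus \<Gamma> e}"
      using that by (auto simp: star_def doubleton_eq_iff)
    have "missed w \<subseteq> insert 0 (Suc ` missed v)"
    proof
      fix j
      assume j: "j \<in> missed w"
      show "j \<in> insert 0 (Suc ` missed v)"
      proof (cases j)
        case (Suc i)
        have "w \<in> edge_ball u (Suc i)" if "v \<in> edge_ball u i"
          using ev that by auto
        then show ?thesis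
          using j Suc by (auto simp: missed_def)
      qed simp
    qed
    then have "card (missed w) \<le> card (insert 0 (Suc ` missed v))"
      by (rule card_mono[rotated]) (simp add: missed_def)
    also have "\<dots> \<le> card (missed v) + 1"
      by (simp add: missed_def card_insert_if card_image)
    finally show ?thesis .
  qed
  have "edgewise_Lipschitz 1 (linear_extension h)"
  proof (rule edgewise_Lipschitz_linear_extension)
    fix e
    assume e: "e \<in> edges \<Gamma>"
    have "\<bar>real (card (missed (terminus \<Gamma> e))) - real (card (missed (origin \<Gamma> e)))\<bar> \<le> 1"
      using step[OF e, of "origin \<Gamma> e" "terminus \<Gamma> e"] step[OF e, of "terminus \<Gamma> e" "origin \<Gamma> e"]
      by (simp add: insert_commute)
    then have "\<bar>h (terminus \<Gamma> e) - h (origin \<Gamma> e)\<bar> \<le> \<delta> * 1"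
      using \<delta>(1) unfolding h_def right_diff_distrib[symmetric] abs_mult by (simp add: mult_left_mono)
    then show "\<bar>h (terminus \<Gamma> e) - h (origin \<Gamma> e)\<bar> \<le> 1 * len \<Gamma> e"
      using \<delta>(2)[OF e] by simp
  qed simp
  note lip = path_dist_Lipschitz[OF this, of "Vertex u" "Vertex v" for v]
  have "v \<in> (\<Union>j<n. edge_ball u j)"
    if v: "v \<in> verts \<Gamma>" "path_dist \<Gamma> (Vertex u) (Vertex v) \<le> R" for v
  proof (rule ccontr)
    assume "v \<notin> (\<Union>j<n. edge_ball u j)"
    then have "missed v = {..<n}"
      by (auto simp: missed_def)
    then have "h v = real n * \<delta>"
      by (simp add: h_def)
    moreover have "h u = 0"
      by (simp add: h_def missed_def centre_in_edge_ball)
    moreover have "\<bar>h v - h u\<bar> \<le> path_dist \<Gamma> (Vertex u) (Vertex v)"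
      using lip[of v] u v by (simp add: linear_extension_def)
    ultimately show False
      using v n by simp
  qed
  then have "{v \<in> verts \<Gamma>. path_dist \<Gamma> (Vertex u) (Vertex v) \<le> R} \<subseteq> (\<Union>j<n. edge_ball u j)"
    by blast
  moreover have "finite (\<Union>j<n. edge_ball u j)"
    using finite_edge_ball[OF fin u] by simp
  ultimately show ?thesis
    by (rule finite_subset)
qed

text \<open>
  A point of given depth is determined by its nearest vertex, an edge at this vertex and one of two
  positions on it; the nearest vertex of a point in a ball lies in a slightly larger ball.
\<close>

lemma finite_points_of_depth_in_ball:
  assumes fin: "\<And>v. v \<in> verts \<Gamma> \<Longrightarrow> finite (star v)"
    and \<delta>: "0 < \<delta>" "\<And>e. e \<in> edges \<Gamma> \<Longrightarrow> \<delta> \<le> len \<Gamma> e"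
    and q: "q \<in> points \<Gamma>"
  shows "finite {x \<in> points \<Gamma>. depth x = a \<and> path_dist \<Gamma> q x \<le> R}" (is "finite ?S")
proof -
  obtain u where u: "u \<in> verts \<Gamma>" "pl_path \<Gamma> q (depth q) (Vertex u)"
    using nearest_vertex[OF q] by blast
  define W where "W = {v \<in> verts \<Gamma>. path_dist \<Gamma> (Vertex u) (Vertex v) \<le> depth q + R + a}"
  have "?S \<subseteq> (\<Union>v \<in> W. insert (Vertex v) (\<Union>e \<in> star v. {Inner e a, Inner e (len \<Gamma> e - a)}))"
  proof
    fix x
    assume x: "x \<in> ?S"
    then obtain v where v: "v \<in> verts \<Gamma>" "pl_path \<Gamma> x a (Vertex v)"
      and near: "x \<in> insert (Vertex v) (\<Union>e \<in> star v. {Inner e a, Inner e (len \<Gamma> e - a)})"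
      using nearest_vertex[of x] by blast
    have "path_dist \<Gamma> (Vertex u) (Vertex v)
        \<le> path_dist \<Gamma> (Vertex u) q + path_dist \<Gamma> q x + path_dist \<Gamma> x (Vertex v)"
      using path_dist_triangle[of "Vertex u" q "Vertex v"] path_dist_triangle[of q x "Vertex v"]
        u(1) v(1) q x by simp
    also have "\<dots> \<le> depth q + R + a"
      using path_dist_le[OF pl_path_sym[OF u(2)]] path_dist_le[OF v(2)] x by simp
    finally show "x \<in> (\<Union>v \<in> W. insert (Vertex v) (\<Union>e \<in> star v. {Inner e a, Inner e (len \<Gamma> e - a)}))"
      using v(1) near unfolding W_def by blast
  qed
  moreover have "finite W"
    unfolding W_def by (rule finite_vertex_ball[OF fin \<delta> u(1)])
  then have "finite (\<Union>v \<in> W. insert (Vertex v) (\<Union>e \<in> star v. {Inner e a, Inner e (len \<Gamma> e - a)}))"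
    using fin by (auto simp: W_def)
  ultimately show ?thesis
    by (rule finite_subset)
qed

end

section \<open>Cocompact actions on graphs\<close>

sublocale metric_graph \<subseteq> path_connected_graph \<Gamma>
proof -
  interpret weighted_graph \<Gamma>
    by unfold_locales (auto simp: origin_in_verts terminus_in_verts len_pos)
  show "path_connected_graph \<Gamma>"
    using connected by (simp add: connected_space_iff_path_connected)
qed

context metric_G_graph
begin

lemma act_inv_act [simp]:
  "g \<in> carrier G \<Longrightarrow> x \<in> points \<Gamma> \<Longrightarrow> \<phi> (inv g) (\<phi> g x) = x"
  "g \<in> carrier G \<Longrightarrow> x \<in> points \<Gamma> \<Longrightarrow> \<phi> g (\<phi> (inv g) x) = x"
  using act_mult[of g "inv g" x] act_mult[of "inv g" g x] by (simp_all add: act_one)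

lemma orbit_self: "x \<in> points \<Gamma> \<Longrightarrow> x \<in> orbit G \<phi> x"
  using act_one by (force simp: orbit_def)

lemma orbit_act:
  assumes g: "g \<in> carrier G" and x: "x \<in> points \<Gamma>"
  shows "orbit G \<phi> (\<phi> g x) = orbit G \<phi> x"
proof
  show "orbit G \<phi> (\<phi> g x) \<subseteq> orbit G \<phi> x"
    using g x act_mult[symmetric] by (auto simp: orbit_def)
  show "orbit G \<phi> x \<subseteq> orbit G \<phi> (\<phi> g x)"
  proof
    fix y
    assume "y \<in> orbit G \<phi> x"
    then obtain h where h: "h \<in> carrier G" "y = \<phi> h x"
      by (auto simp: orbit_def)
    then have "y = \<phi> (inv g \<otimes> h) (\<phi> g x)"
      using g x by (simp add: act_mult act_closed)
    then show "y \<in> orbit G \<phi> (\<phi> g x)"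
      using g h unfolding orbit_def by blast
  qed
qed

lemma path_dist_act_swap:
  assumes "g \<in> carrier G" "x \<in> points \<Gamma>" "y \<in> points \<Gamma>"
  shows "path_dist \<Gamma> x (\<phi> g y) = path_dist \<Gamma> (\<phi> (inv g) x) y"
  using act_isometric[of "inv g" x "\<phi> g y"] assms by (simp add: act_closed)

lemma based_length_mult_le:
  assumes "q \<in> points \<Gamma>" "g \<in> carrier G" "h \<in> carrier G"
  shows "based_length \<Gamma> \<phi> q (g \<otimes> h) \<le> based_length \<Gamma> \<phi> q g + based_length \<Gamma> \<phi> q h"
proof -
  have "path_dist \<Gamma> q (\<phi> h (\<phi> g q)) \<le> path_dist \<Gamma> q (\<phi> h q) + path_dist \<Gamma> (\<phi> h q) (\<phi> h (\<phi> g q))"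
    using assms by (intro path_dist_triangle) (auto simp: act_closed)
  then show ?thesis
    using assms by (simp add: based_length_def act_mult act_isometric act_closed)
qed

text \<open>
  An isometry that maps vertices to vertices does not increase the distance to the nearest vertex;
  applied to the inverse as well, this shows that the depth is invariant.
\<close>

lemma depth_act_le:
  assumes g: "g \<in> carrier G" and x: "x \<in> points \<Gamma>"
  shows "depth (\<phi> g x) \<le> depth x"
proof -
  obtain v where v: "v \<in> verts \<Gamma>" "pl_path \<Gamma> x (depth x) (Vertex v)"
    using nearest_vertex[OF x] by blast
  obtain w where w: "w \<in> verts \<Gamma>" "\<phi> g (Vertex v) = Vertex w"
    using act_vertex[OF g v(1)] by blast
  have "\<bar>depth (Vertex w) - depth (\<phi> g x)\<bar> \<le> 1 * path_dist \<Gamma> (\<phi> g x) (Vertex w)"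
    using g x w by (intro path_dist_Lipschitz[OF edgewise_Lipschitz_depth]) (auto simp: act_closed)
  also have "\<dots> = path_dist \<Gamma> x (Vertex v)"
    using act_isometric[OF g x, of "Vertex v"] v w by simp
  also have "\<dots> \<le> depth x"
    by (rule path_dist_le[OF v(2)])
  finally show ?thesis
    by simp
qed

lemma depth_act:
  assumes "g \<in> carrier G" "x \<in> points \<Gamma>"
  shows "depth (\<phi> g x) = depth x"
  using depth_act_le[OF assms] depth_act_le[of "inv g" "\<phi> g x"] assms by (simp add: act_closed)

text \<open>The length of an edge is twice the supremum of the depths of its points.\<close>

lemma len_act:
  assumes g: "g \<in> carrier G" and e: "e \<in> edges \<Gamma>" "e' \<in> edges \<Gamma>"
    and im: "\<phi> g ` open_edge \<Gamma> e = open_edge \<Gamma> e'"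
  shows "len \<Gamma> e' = len \<Gamma> e"
proof -
  have depths: "depth ` open_edge \<Gamma> a = {0<..len \<Gamma> a / 2}" if a: "a \<in> edges \<Gamma>" for a
  proof
    show "depth ` open_edge \<Gamma> a \<subseteq> {0<..len \<Gamma> a / 2}"
      by (auto simp: open_edge_def min_def)
    show "{0<..len \<Gamma> a / 2} \<subseteq> depth ` open_edge \<Gamma> a"
    proof
      fix t
      assume "t \<in> {0<..len \<Gamma> a / 2}"
      then have "t = depth (Inner a t)" "Inner a t \<in> open_edge \<Gamma> a"
        using len_positive[OF a] by (auto simp: min_def)
      then show "t \<in> depth ` open_edge \<Gamma> a"
        by blast
    qed
  qed
  have "open_edge \<Gamma> e \<subseteq> points \<Gamma>"
    using e by (auto simp: points_def)
  then have "depth ` \<phi> g ` open_edge \<Gamma> e = depth ` open_edge \<Gamma> e"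
    using depth_act[OF g] by (force simp: image_image intro!: image_cong)
  then have "{0<..len \<Gamma> e' / 2} = {0<..len \<Gamma> e / 2}"
    using im depths e by simp
  moreover have "len \<Gamma> e / 2 \<in> {0<..len \<Gamma> e / 2}" "len \<Gamma> e' / 2 \<in> {0<..len \<Gamma> e' / 2}"
    using len_positive e by auto
  ultimately have "len \<Gamma> e / 2 \<in> {0<..len \<Gamma> e' / 2}" "len \<Gamma> e' / 2 \<in> {0<..len \<Gamma> e / 2}"
    by simp_all
  then show ?thesis
    by simp
qed

lemma topspace_orbit_space: "topspace (orbit_space G \<Gamma> \<phi>) = orbits G (points \<Gamma>) \<phi>"
proof
  show "topspace (orbit_space G \<Gamma> \<phi>) \<subseteq> orbits G (points \<Gamma>) \<phi>"
    using openin_topspace[of "orbit_space G \<Gamma> \<phi>"] by (simp only: openin_orbit_space)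
  have "{x \<in> points \<Gamma>. orbit G \<phi> x \<in> orbits G (points \<Gamma>) \<phi>} = points \<Gamma>"
    by (auto simp: orbits_def)
  then have "openin (orbit_space G \<Gamma> \<phi>) (orbits G (points \<Gamma>) \<phi>)"
    using openin_topspace[of "cw_topology \<Gamma>"] by (simp add: openin_orbit_space)
  then show "orbits G (points \<Gamma>) \<phi> \<subseteq> topspace (orbit_space G \<Gamma> \<phi>)"
    by (rule openin_subset)
qed

lemma cocompact_if_compact_translates_cover:
  assumes K: "compactin (cw_topology \<Gamma>) K"
    and cover: "\<And>x. x \<in> points \<Gamma> \<Longrightarrow> \<exists>g \<in> carrier G. x \<in> \<phi> g ` K"
  shows "cocompact G \<Gamma> \<phi>"
proof -
  have K_points: "K \<subseteq> points \<Gamma>"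
    using compactin_subset_topspace[OF K] by simp
  have "continuous_map (cw_topology \<Gamma>) (orbit_space G \<Gamma> \<phi>) (orbit G \<phi>)"
    unfolding continuous_map topspace_orbit_space topspace_cw_topology
    by (auto simp: orbits_def openin_orbit_space)
  then have "compactin (orbit_space G \<Gamma> \<phi>) (orbit G \<phi> ` K)"
    by (rule image_compactin[OF K])
  moreover have "orbit G \<phi> x \<in> orbit G \<phi> ` K" if "x \<in> points \<Gamma>" for x
    using cover[OF that] orbit_act K_points by blast
  then have "orbit G \<phi> ` K = topspace (orbit_space G \<Gamma> \<phi>)"
    unfolding topspace_orbit_space orbits_def using K_points by blast
  ultimately show ?thesis
    by (simp add: cocompact_def compact_space_def)
qed

text \<open>
  Compactness of the orbit space, stated on the graph: only the union of the translates of each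
  set of the cover has to be open.
\<close>

lemma cocompact_finite_subcover:
  assumes cc: "cocompact G \<Gamma> \<phi>"
    and sub: "\<And>i. i \<in> I \<Longrightarrow> A i \<subseteq> points \<Gamma>"
    and op: "\<And>i. i \<in> I \<Longrightarrow> openin (cw_topology \<Gamma>) (\<Union>g \<in> carrier G. \<phi> g ` A i)"
    and cover: "points \<Gamma> \<subseteq> (\<Union>i \<in> I. A i)"
  shows "\<exists>J \<subseteq> I. finite J \<and> points \<Gamma> \<subseteq> (\<Union>i \<in> J. \<Union>g \<in> carrier G. \<phi> g ` A i)"
proof -
  have saturation: "{x \<in> points \<Gamma>. orbit G \<phi> x \<in> orbit G \<phi> ` A i} = (\<Union>g \<in> carrier G. \<phi> g ` A i)"
    if i: "i \<in> I" for i
  proof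
    show "{x \<in> points \<Gamma>. orbit G \<phi> x \<in> orbit G \<phi> ` A i} \<subseteq> (\<Union>g \<in> carrier G. \<phi> g ` A i)"
    proof
      fix x
      assume "x \<in> {x \<in> points \<Gamma>. orbit G \<phi> x \<in> orbit G \<phi> ` A i}"
      then obtain y where "y \<in> A i" "x \<in> orbit G \<phi> y"
        using orbit_self by auto
      then show "x \<in> (\<Union>g \<in> carrier G. \<phi> g ` A i)"
        by (auto simp: orbit_def)
    qed
    show "(\<Union>g \<in> carrier G. \<phi> g ` A i) \<subseteq> {x \<in> points \<Gamma>. orbit G \<phi> x \<in> orbit G \<phi> ` A i}"
    proof clarify
      fix g x
      assume g: "g \<in> carrier G" and x: "x \<in> A i"
      then have px: "x \<in> points \<Gamma>"
        using sub i by blast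
      show "\<phi> g x \<in> points \<Gamma> \<and> orbit G \<phi> (\<phi> g x) \<in> orbit G \<phi> ` A i"
        using g px x by (simp add: act_closed orbit_act)
    qed
  qed
  have "openin (orbit_space G \<Gamma> \<phi>) (orbit G \<phi> ` A i)" if "i \<in> I" for i
    unfolding openin_orbit_space saturation[OF that]
    using op[OF that] sub[OF that] by (auto simp: orbits_def)
  then have "\<forall>U \<in> (\<lambda>i. orbit G \<phi> ` A i) ` I. openin (orbit_space G \<Gamma> \<phi>) U"
    by blast
  moreover have "topspace (orbit_space G \<Gamma> \<phi>) \<subseteq> \<Union>((\<lambda>i. orbit G \<phi> ` A i) ` I)"
    unfolding topspace_orbit_space orbits_def using cover by blast
  ultimately obtain \<F> where \<F>: "finite \<F>" "\<F> \<subseteq> (\<lambda>i. orbit G \<phi> ` A i) ` I"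
      "topspace (orbit_space G \<Gamma> \<phi>) \<subseteq> \<Union>\<F>"
    using cc unfolding cocompact_def compact_space_alt by meson
  then obtain J where J: "J \<subseteq> I" "finite J" "\<F> = (\<lambda>i. orbit G \<phi> ` A i) ` J"
    by (meson finite_subset_image)
  have "x \<in> (\<Union>i \<in> J. \<Union>g \<in> carrier G. \<phi> g ` A i)" if x: "x \<in> points \<Gamma>" for x
  proof -
    have "orbit G \<phi> x \<in> \<Union>\<F>"
      using \<F>(3) x unfolding topspace_orbit_space orbits_def by blast
    then obtain i where "i \<in> J" "orbit G \<phi> x \<in> orbit G \<phi> ` A i"
      using J(3) by blast
    then show ?thesis
      using saturation[of i] J(1) x by blast
  qed
  then show ?thesis
    using J(1,2) by blast
qed

text \<open>
  The orbits of the open edges, together with the complement of the set of midpoints, form an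
  open cover of the orbit space. As midpoints go to midpoints, an open edge can be dropped from
  the cover only if another one in its orbit is kept.
\<close>

lemma finite_edge_orbits:
  assumes cc: "cocompact G \<Gamma> \<phi>"
  shows "\<exists>E \<subseteq> edges \<Gamma>. finite E \<and>
    (\<forall>e \<in> edges \<Gamma>. \<exists>e\<^sub>0 \<in> E. \<exists>g \<in> carrier G. \<phi> g ` open_edge \<Gamma> e\<^sub>0 = open_edge \<Gamma> e)"
proof -
  define mid where "mid e = (Inner e (len \<Gamma> e / 2) :: ('v, 'e) point)" for e
  define A where "A i = (case i of None \<Rightarrow> points \<Gamma> - mid ` edges \<Gamma> | Some e \<Rightarrow> open_edge \<Gamma> e)" for i
  let ?I = "insert None (Some ` edges \<Gamma>)"
  have mid: "mid e \<in> open_edge \<Gamma> e" if "e \<in> edges \<Gamma>" for e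
    using len_positive[OF that] by (simp add: mid_def)
  have open_edge_points: "open_edge \<Gamma> e \<subseteq> points \<Gamma>" if "e \<in> edges \<Gamma>" for e
    using that by (auto simp: points_def)
  have mid_act: "\<phi> g x \<in> mid ` edges \<Gamma>" if g: "g \<in> carrier G" and x: "x \<in> mid ` edges \<Gamma>" for g x
  proof -
    obtain e where e: "e \<in> edges \<Gamma>" "x = mid e"
      using x by blast
    obtain e' where e': "e' \<in> edges \<Gamma>" "\<phi> g ` open_edge \<Gamma> e = open_edge \<Gamma> e'"
      using act_edge[OF g e(1)] by blast
    have "\<phi> g x \<in> open_edge \<Gamma> e'"
      using mid[OF e(1)] e(2) e'(2) by blast
    then obtain t where t: "\<phi> g x = Inner e' t"
      by (auto simp: open_edge_def)
    have "depth (\<phi> g x) = depth x"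
      using g e mid open_edge_points by (intro depth_act) blast+
    then have "t = len \<Gamma> e' / 2"
      using t e len_act[OF g e(1) e'] by (auto simp: mid_def min_def split: if_splits)
    then show ?thesis
      using e'(1) t by (simp add: mid_def)
  qed
  have A_None: "\<phi> g ` A None \<subseteq> A None" if g: "g \<in> carrier G" for g
  proof clarify
    fix x
    assume "x \<in> A None"
    then have x: "x \<in> points \<Gamma>" "x \<notin> mid ` edges \<Gamma>"
      by (auto simp: A_def)
    then have "\<phi> g x \<notin> mid ` edges \<Gamma>"
      using mid_act[of "inv g" "\<phi> g x"] g by auto
    then show "\<phi> g x \<in> A None"
      using g x by (simp add: A_def act_closed)
  qed
  have "\<exists>J \<subseteq> ?I. finite J \<and> points \<Gamma> \<subseteq> (\<Union>i \<in> J. \<Union>g \<in> carrier G. \<phi> g ` A i)"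
  proof (rule cocompact_finite_subcover[OF cc])
    show "A i \<subseteq> points \<Gamma>" if "i \<in> ?I" for i
      using that open_edge_points unfolding A_def by (cases i) auto
    show "points \<Gamma> \<subseteq> (\<Union>i \<in> ?I. A i)"
      using mid by (auto simp: A_def)
    show "openin (cw_topology \<Gamma>) (\<Union>g \<in> carrier G. \<phi> g ` A i)" if "i \<in> ?I" for i
    proof (cases i)
      case None
      have "A None \<subseteq> (\<Union>g \<in> carrier G. \<phi> g ` A None)"
        using act_one one_closed by (force simp: A_def)
      then have "(\<Union>g \<in> carrier G. \<phi> g ` A None) = A None"
        using A_None by blast
      moreover have "openin (cw_topology \<Gamma>) (A None)"
      proof (rule openin_cofinite_preimages)
        fix e
        assume e: "e \<in> edges \<Gamma>"
        then have "{t \<in> {0..len \<Gamma> e}. char_map \<Gamma> e t \<notin> A None} \<subseteq> {len \<Gamma> e / 2}"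
          using char_map_in_points[OF e] by (auto simp: A_def mid_def char_map_def split: if_splits)
        then show "finite {t \<in> {0..len \<Gamma> e}. char_map \<Gamma> e t \<notin> A None}"
          by (rule finite_subset) simp
      qed (auto simp: A_def)
      ultimately show ?thesis
        using None by simp
    next
      case (Some e)
      have "openin (cw_topology \<Gamma>) (\<phi> g ` open_edge \<Gamma> e)" if "g \<in> carrier G" for g
        using Some \<open>i \<in> ?I\<close> act_edge[OF that, of e] openin_open_edge by auto
      then show ?thesis
        using Some by (auto simp: A_def)
    qed
  qed
  then obtain J where J: "J \<subseteq> ?I" "finite J" "points \<Gamma> \<subseteq> (\<Union>i \<in> J. \<Union>g \<in> carrier G. \<phi> g ` A i)"
    by blast
  have "\<exists>e\<^sub>0 \<in> {e. Some e \<in> J}. \<exists>g \<in> carrier G. \<phi> g ` open_edge \<Gamma> e\<^sub>0 = open_edge \<Gamma> e"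
    if e: "e \<in> edges \<Gamma>" for e
  proof -
    have "mid e \<in> points \<Gamma>"
      using mid[OF e] open_edge_points[OF e] by blast
    then obtain i g where ig: "i \<in> J" "g \<in> carrier G" "mid e \<in> \<phi> g ` A i"
      using J(3) by blast
    have "i \<noteq> None"
    proof
      assume "i = None"
      then have "mid e \<in> A None"
        using A_None[OF ig(2)] ig(3) by blast
      then show False
        using e by (simp add: A_def)
    qed
    then obtain e\<^sub>0 where e\<^sub>0: "i = Some e\<^sub>0" "e\<^sub>0 \<in> edges \<Gamma>"
      using J(1) ig(1) by blast
    obtain e' where e': "\<phi> g ` open_edge \<Gamma> e\<^sub>0 = open_edge \<Gamma> e'"
      using act_edge[OF ig(2) e\<^sub>0(2)] by blast
    then have "mid e \<in> open_edge \<Gamma> e'"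
      using ig(3) e\<^sub>0(1) by (simp add: A_def)
    then have "e' = e"
      by (simp add: mid_def)
    then show ?thesis
      using e' e\<^sub>0(1) ig(1,2) by auto
  qed
  moreover have "finite {e. Some e \<in> J}"
    using finite_vimageI[OF J(2), of Some] by (simp add: vimage_def)
  moreover have "{e. Some e \<in> J} \<subseteq> edges \<Gamma>"
    using J(1) by auto
  ultimately show ?thesis
    by blast
qed

lemma edge_lengths_bounded_below:
  assumes cc: "cocompact G \<Gamma> \<phi>"
  shows "\<exists>\<delta> > 0. \<forall>e \<in> edges \<Gamma>. \<delta> \<le> len \<Gamma> e"
proof -
  obtain E where E: "E \<subseteq> edges \<Gamma>" "finite E"
    and rep: "\<And>e. e \<in> edges \<Gamma> \<Longrightarrow> \<exists>e\<^sub>0 \<in> E. \<exists>g \<in> carrier G. \<phi> g ` open_edge \<Gamma> e\<^sub>0 = open_edge \<Gamma> e"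
    using finite_edge_orbits[OF cc] by blast
  have "\<exists>e\<^sub>0 \<in> E. len \<Gamma> e = len \<Gamma> e\<^sub>0" if "e \<in> edges \<Gamma>" for e
    using rep[OF that] len_act that E(1) by blast
  then have *: "len \<Gamma> e \<in> len \<Gamma> ` E" if "e \<in> edges \<Gamma>" for e
    using that by blast
  then have "Min (len \<Gamma> ` E) \<le> len \<Gamma> e" if "e \<in> edges \<Gamma>" for e
    using E(2) that by (intro Min_le) auto
  moreover have "0 < Min (len \<Gamma> ` E)"
  proof -
    have "len \<Gamma> ` E \<noteq> {}"
      using * edges_nonempty by blast
    then have "Min (len \<Gamma> ` E) \<in> len \<Gamma> ` E"
      using E(2) by (intro Min_in) auto
    then show ?thesis
      using E(1) len_positive by auto
  qed
  ultimately show ?thesis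
    by blast
qed

text \<open>
  The open balls around \<open>q\<close> of integer radius cover the graph, and the translates of each of them
  form an open set because the distance to a point is continuous in the weak topology.
\<close>

lemma orbit_is_cobounded:
  assumes cc: "cocompact G \<Gamma> \<phi>" and q: "q \<in> points \<Gamma>"
  shows "\<exists>R. \<forall>x \<in> points \<Gamma>. \<exists>g \<in> carrier G. path_dist \<Gamma> x (\<phi> g q) \<le> R"
proof -
  define B where "B n = {x \<in> points \<Gamma>. path_dist \<Gamma> q x < real n}" for n
  have lip: "edgewise_Lipschitz 1 (path_dist \<Gamma> p)" if p: "p \<in> points \<Gamma>" for p
  proof (rule edgewise_LipschitzI)
    fix e s t
    assume e: "e \<in> edges \<Gamma>" and st: "0 \<le> s" "s \<le> t" "t \<le> len \<Gamma> e"
    let ?x = "char_map \<Gamma> e s" and ?y = "char_map \<Gamma> e t"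
    have "path_dist \<Gamma> ?x ?y \<le> t - s"
      using path_dist_edge[OF e, of s t] st by simp
    then show "\<bar>path_dist \<Gamma> p ?y - path_dist \<Gamma> p ?x\<bar> \<le> 1 * (t - s)"
      using path_dist_triangle[of p ?x ?y] path_dist_triangle[of p ?y ?x] path_dist_sym[of ?x ?y]
        p char_map_in_points[OF e] by (simp add: abs_le_iff)
  qed simp
  have translate: "\<phi> g ` B n = {x \<in> points \<Gamma>. path_dist \<Gamma> (\<phi> g q) x < real n}" if g: "g \<in> carrier G" for g n
  proof
    show "\<phi> g ` B n \<subseteq> {x \<in> points \<Gamma>. path_dist \<Gamma> (\<phi> g q) x < real n}"
      using g q by (auto simp: B_def act_closed act_isometric)
    show "{x \<in> points \<Gamma>. path_dist \<Gamma> (\<phi> g q) x < real n} \<subseteq> \<phi> g ` B n"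
    proof
      fix x
      assume x: "x \<in> {x \<in> points \<Gamma>. path_dist \<Gamma> (\<phi> g q) x < real n}"
      then have "\<phi> (inv g) x \<in> B n"
        using path_dist_act_swap[OF g, of x q] g q by (simp add: B_def act_closed path_dist_sym)
      then show "x \<in> \<phi> g ` B n"
        using x g by (force intro: image_eqI[of _ _ "\<phi> (inv g) x"])
    qed
  qed
  have "\<exists>J \<subseteq> UNIV. finite J \<and> points \<Gamma> \<subseteq> (\<Union>n \<in> J. \<Union>g \<in> carrier G. \<phi> g ` B n)"
  proof (rule cocompact_finite_subcover[OF cc])
    show "openin (cw_topology \<Gamma>) (\<Union>g \<in> carrier G. \<phi> g ` B n)" for n
      using openin_edgewise_Lipschitz[OF lip] q by (auto simp: translate act_closed)
    show "points \<Gamma> \<subseteq> (\<Union>n \<in> UNIV. B n)"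
      using reals_Archimedean2 by (auto simp: B_def)
  qed (auto simp: B_def)
  then obtain J where J: "finite J" "points \<Gamma> \<subseteq> (\<Union>n \<in> J. \<Union>g \<in> carrier G. \<phi> g ` B n)"
    by blast
  have "\<exists>g \<in> carrier G. path_dist \<Gamma> x (\<phi> g q) \<le> real (Max J)" if x: "x \<in> points \<Gamma>" for x
  proof -
    obtain n g where n: "n \<in> J" "g \<in> carrier G" "x \<in> \<phi> g ` B n"
      using J(2) x by blast
    then have "path_dist \<Gamma> x (\<phi> g q) < real n"
      using translate by (simp add: path_dist_sym)
    moreover have "n \<le> Max J"
      using J(1) n(1) by simp
    ultimately show ?thesis
      using n(2) by (intro bexI[of _ g]) auto
  qed
  then show ?thesis
    by blast
qed

text \<open>
  All points of an orbit have the same depth, hence a ball contains only finitely many of them; as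
  the stabilizer is trivial, each of them belongs to a single group element.
\<close>

lemma finite_based_length_ball:
  assumes lc: "locally_compact_space (cw_topology \<Gamma>)" and cc: "cocompact G \<Gamma> \<phi>"
    and q: "q \<in> points \<Gamma>" and stab: "stabilizer G \<phi> q = {\<one>}"
  shows "finite {g \<in> carrier G. based_length \<Gamma> \<phi> q g \<le> R}" (is "finite ?S")
proof -
  obtain \<delta> where \<delta>: "0 < \<delta>" "\<And>e. e \<in> edges \<Gamma> \<Longrightarrow> \<delta> \<le> len \<Gamma> e"
    using edge_lengths_bounded_below[OF cc] by blast
  have "finite {x \<in> points \<Gamma>. depth x = depth q \<and> path_dist \<Gamma> q x \<le> R}"
    by (rule finite_points_of_depth_in_ball[OF finite_star[OF lc] \<delta> q])
  then have "finite ((\<lambda>g. \<phi> g q) ` ?S)"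
    by (rule finite_subset[rotated]) (auto simp: based_length_def act_closed depth_act q)
  moreover have "inj_on (\<lambda>g. \<phi> g q) (carrier G)"
  proof (rule inj_onI)
    fix g h
    assume gh: "g \<in> carrier G" "h \<in> carrier G" "\<phi> g q = \<phi> h q"
    then have "\<phi> (g \<otimes> inv h) q = q"
      using q by (simp add: act_mult)
    then have "g \<otimes> inv h \<in> stabilizer G \<phi> q"
      using gh by (simp add: stabilizer_def)
    then show "g = h"
      using stab gh by (metis inv_closed inv_equality inv_inv singletonD)
  qed
  then have "inj_on (\<lambda>g. \<phi> g q) ?S"
    by (rule inj_on_subset) blast
  ultimately show ?thesis
    by (rule finite_imageD)
qed

end

section \<open>Graph-like length functions\<close>

context graph_like_length
begin

lemma length_mult_le:
  assumes "g \<in> carrier G" "h \<in> carrier G"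
  shows "l (g \<otimes> h) \<le> l g + l h"
  using A3[of g "inv h"] A2[of h] assms by (simp add: gromov_product_def)

text \<open>
  The condition on the Gromov product in A5 says that \<open>l (g \<otimes> inv x) \<le> l g - (1 - \<epsilon>) * l x\<close>, and
  \<open>l\<close> is bounded away from zero on the finitely many nontrivial elements of a ball. So every long
  element is shortened by a definite amount on dividing it by a short one.
\<close>

lemma uniform_descent:
  obtains K c where "0 < K" "0 < c" "\<And>g. g \<in> carrier G \<Longrightarrow> g \<noteq> \<one> \<Longrightarrow> c \<le> l g"
    "\<And>g. g \<in> carrier G \<Longrightarrow> K < l g \<Longrightarrow> \<exists>x \<in> carrier G. l x \<le> K \<and> l (g \<otimes> inv x) + c \<le> l g"
proof -
  obtain \<epsilon> K where \<epsilon>: "0 \<le> \<epsilon>" "\<epsilon> < 1" and K: "0 < K"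
    and step: "\<And>g. g \<in> carrier G \<Longrightarrow> K < l g \<Longrightarrow> \<exists>x \<in> carrier G. 0 < l x \<and> l x \<le> K \<and>
      gromov_product G l (g \<otimes> inv x) (inv x) \<le> \<epsilon> * l x / 2"
    using A5 by blast
  define L where "L = insert K (l ` {g \<in> carrier G. l g \<le> K \<and> g \<noteq> \<one>})"
  have "finite {g \<in> carrier G. l g \<le> K \<and> g \<noteq> \<one>}"
    using K by (intro finite_subset[OF _ A4[of K]]) auto
  then have fin: "finite L"
    by (simp add: L_def)
  have "0 < l g" if "g \<in> carrier G" "g \<noteq> \<one>" for g
    using A1[OF that(1)] nonneg[OF that(1)] that(2) by simp
  then have pos: "0 < y" if "y \<in> L" for y
    using that K by (auto simp: L_def)
  define \<mu> where "\<mu> = Min L"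
  have \<mu>: "0 < \<mu>"
    unfolding \<mu>_def using fin pos by (simp add: L_def)
  have \<mu>_le: "\<mu> \<le> l g" if "g \<in> carrier G" "g \<noteq> \<one>" for g
  proof (cases "l g \<le> K")
    case True
    then show ?thesis
      unfolding \<mu>_def using fin that by (intro Min_le) (auto simp: L_def)
  next
    case False
    have "\<mu> \<le> K"
      unfolding \<mu>_def using fin by (intro Min_le) (auto simp: L_def)
    then show ?thesis
      using False by simp
  qed
  define c where "c = (1 - \<epsilon>) * \<mu>"
  have c: "0 < c"
    using \<mu> \<epsilon> by (simp add: c_def)
  have "c \<le> \<mu>"
    using \<mu> \<epsilon> by (simp add: c_def mult_le_cancel_right1)
  then have "c \<le> l g" if "g \<in> carrier G" "g \<noteq> \<one>" for g
    using \<mu>_le[OF that] by simp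
  moreover have "\<exists>x \<in> carrier G. l x \<le> K \<and> l (g \<otimes> inv x) + c \<le> l g"
    if g: "g \<in> carrier G" "K < l g" for g
  proof -
    obtain x where x: "x \<in> carrier G" "0 < l x" "l x \<le> K"
      and gp: "gromov_product G l (g \<otimes> inv x) (inv x) \<le> \<epsilon> * l x / 2"
      using step[OF g] by blast
    have "g \<otimes> inv x \<otimes> inv (inv x) = g"
      using g x by (simp add: m_assoc)
    then have "l (g \<otimes> inv x) + l x - l g \<le> \<epsilon> * l x"
      using gp x by (simp add: gromov_product_def A2)
    moreover have "c \<le> (1 - \<epsilon>) * l x"
      using \<mu>_le[of x] x A1[of x] \<epsilon> unfolding c_def by (intro mult_left_mono) auto
    ultimately have "l (g \<otimes> inv x) + c \<le> l g"
      by (simp add: algebra_simps)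
    then show ?thesis
      using x by blast
  qed
  ultimately show ?thesis
    using that[OF K c] by blast
qed

text \<open>
  In each step of the descent the value of \<open>m\<close> drops by at most its maximum \<open>M\<close> on the ball,
  while \<open>l\<close> drops by at least \<open>c\<close>. The identity has to be treated separately, as \<open>l\<close> gives no
  room there.
\<close>

lemma subadditive_le_length:
  assumes subadd: "\<And>g h. g \<in> carrier G \<Longrightarrow> h \<in> carrier G \<Longrightarrow> m (g \<otimes> h) \<le> m g + m h"
    and one: "m \<one> \<le> 0"
  shows "\<exists>C \<ge> 0. \<forall>g \<in> carrier G. m g \<le> C * l g"
proof -
  obtain K c where K: "0 < K" and c: "0 < c"
    and c_le: "\<And>g. g \<in> carrier G \<Longrightarrow> g \<noteq> \<one> \<Longrightarrow> c \<le> l g"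
    and descent: "\<And>g. g \<in> carrier G \<Longrightarrow> K < l g \<Longrightarrow> \<exists>x \<in> carrier G. l x \<le> K \<and> l (g \<otimes> inv x) + c \<le> l g"
    using uniform_descent by metis
  define M where "M = Max (insert 0 (m ` {g \<in> carrier G. l g \<le> K}))"
  have fin: "finite (insert 0 (m ` {g \<in> carrier G. l g \<le> K}))"
    using A4[of K] K by simp
  have M: "0 \<le> M" "\<And>x. x \<in> carrier G \<Longrightarrow> l x \<le> K \<Longrightarrow> m x \<le> M"
    unfolding M_def using fin by (auto intro!: Max_ge)
  have main: "m g \<le> M / c * l g" if "g \<in> carrier G" "l g \<le> real n * c" for g n
    using that
  proof (induction n arbitrary: g)
    case 0
    then have "g = \<one>"
      using A1[of g] nonneg[of g] by simp
    then show ?case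
      using one A1[of \<one>] by simp
  next
    case (Suc n)
    show ?case
    proof (cases "K < l g")
      case True
      then obtain x where x: "x \<in> carrier G" "l x \<le> K" "l (g \<otimes> inv x) + c \<le> l g"
        using descent Suc.prems(1) by blast
      have "m (g \<otimes> inv x) \<le> M / c * l (g \<otimes> inv x)"
        using Suc.prems x by (intro Suc.IH) (auto simp: algebra_simps)
      moreover have "m g \<le> m (g \<otimes> inv x) + m x"
        using subadd[of "g \<otimes> inv x" x] Suc.prems x by (simp add: m_assoc)
      moreover have "M / c * (l (g \<otimes> inv x) + c) \<le> M / c * l g"
        using x M(1) c by (intro mult_left_mono) auto
      ultimately show ?thesis
        using M(2)[OF x(1,2)] c by (simp add: distrib_left)
    next
      case False
      show ?thesis
      proof (cases "g = \<one>")
        case True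
        then show ?thesis
          using one A1[of \<one>] by simp
      next
        case False
        have "M / c * c \<le> M / c * l g"
          using c_le[OF Suc.prems(1) False] M(1) c by (intro mult_left_mono) auto
        then show ?thesis
          using M(2)[OF Suc.prems(1)] \<open>\<not> K < l g\<close> c by simp
      qed
    qed
  qed
  have "m g \<le> M / c * l g" if "g \<in> carrier G" for g
  proof -
    obtain n where "l g < real n * c"
      using reals_Archimedean3[OF c] by blast
    then show ?thesis
      using main[OF that, of n] by simp
  qed
  then show ?thesis
    using M(1) c by (intro exI[of _ "M / c"]) simp
qed

lemma generated_by_ball:
  obtains K where "0 < K" "generate G {g \<in> carrier G. l g \<le> K} = carrier G"
proof -
  obtain K c where K: "0 < K" and c: "0 < c"
    and descent: "\<And>g. g \<in> carrier G \<Longrightarrow> K < l g \<Longrightarrow> \<exists>x \<in> carrier G. l x \<le> K \<and> l (g \<otimes> inv x) + c \<le> l g"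
    using uniform_descent by metis
  let ?H = "generate G {g \<in> carrier G. l g \<le> K}"
  have main: "g \<in> ?H" if "g \<in> carrier G" "l g \<le> real n * c" for g n
    using that
  proof (induction n arbitrary: g)
    case 0
    then show ?case
      using K by (intro generate.incl) auto
  next
    case (Suc n)
    show ?case
    proof (cases "K < l g")
      case True
      then obtain x where x: "x \<in> carrier G" "l x \<le> K" "l (g \<otimes> inv x) + c \<le> l g"
        using descent Suc.prems(1) by blast
      have "g \<otimes> inv x \<in> ?H"
        using Suc.prems x by (intro Suc.IH) (auto simp: algebra_simps)
      moreover have "x \<in> ?H"
        using x by (intro generate.incl) simp
      ultimately have "g \<otimes> inv x \<otimes> x \<in> ?H"
        by (rule generate.eng)
      then show ?thesis
        using x Suc.prems by (simp add: m_assoc)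
    next
      case False
      then show ?thesis
        using Suc.prems by (intro generate.incl) auto
    qed
  qed
  have "g \<in> ?H" if "g \<in> carrier G" for g
  proof -
    obtain n where "l g < real n * c"
      using reals_Archimedean3[OF c] by blast
    then show ?thesis
      using main[OF that, of n] by simp
  qed
  moreover have "?H \<subseteq> carrier G"
    by (rule generate_incl) blast
  ultimately show ?thesis
    using that[OF K] by blast
qed

text \<open>
  Suppose that every point lies within \<open>R\<close> of the orbit of \<open>q\<close>. Cutting a path from \<open>q\<close> to its
  translate by \<open>g\<close> into pieces of length at most one and choosing an orbit point near each cut
  gives a chain of group elements whose successive quotients have based length at most
  \<open>2 * R + 1\<close>. There are only finitely many such quotients, so \<open>l g\<close> is bounded by a multiple of
  the number of pieces.
\<close>

lemma length_le_based_length: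
  fixes Y :: "('v, 'e) edge_data"
  assumes Y: "metric_G_graph G Y \<psi>" and lc: "locally_compact_space (cw_topology Y)"
    and cc: "cocompact G Y \<psi>" and q: "q \<in> points Y" and stab: "stabilizer G \<psi> q = {\<one>}"
  shows "\<exists>C \<ge> 0. \<forall>g \<in> carrier G. l g \<le> C * based_length Y \<psi> q g"
proof -
  interpret metric_G_graph G Y \<psi>
    by (rule Y)
  let ?d = "path_dist Y" and ?l = "based_length Y \<psi> q"
  note fin = finite_based_length_ball[OF lc cc q stab]
  obtain R where R: "\<And>x. x \<in> points Y \<Longrightarrow> \<exists>g \<in> carrier G. ?d x (\<psi> g q) \<le> R"
    using orbit_is_cobounded[OF cc q] by blast
  have "0 \<le> R"
    using R[OF q] path_dist_nonneg order_trans by blast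
  define M where "M = Max (insert 0 (l ` {g \<in> carrier G. ?l g \<le> 2 * R + 1}))"
  have M: "0 \<le> M" "\<And>g. g \<in> carrier G \<Longrightarrow> ?l g \<le> 2 * R + 1 \<Longrightarrow> l g \<le> M"
    unfolding M_def using fin by (auto intro!: Max_ge)
  \<comment> \<open>Passing from an orbit point near \<open>x\<close> to an orbit point near \<open>y\<close>.\<close>
  have jump: "l h \<le> l k + M"
    if "k \<in> carrier G" "h \<in> carrier G" "x \<in> points Y" "y \<in> points Y"
      "?d x (\<psi> k q) \<le> R" "?d y (\<psi> h q) \<le> R" "?d x y \<le> 1" for h k x y
  proof -
    have kh: "\<psi> k q \<in> points Y" "\<psi> h q \<in> points Y"
      using that q by (auto simp: act_closed)
    have "?l (h \<otimes> inv k) = ?d (\<psi> k q) (\<psi> h q)"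
      using that q path_dist_act_swap[of "inv k" q "\<psi> h q"]
      by (simp add: based_length_def act_mult act_closed)
    also have "\<dots> \<le> ?d (\<psi> k q) x + ?d x y + ?d y (\<psi> h q)"
      using path_dist_triangle[of "\<psi> k q" x "\<psi> h q"] path_dist_triangle[of x y "\<psi> h q"] kh that
      by simp
    also have "\<dots> \<le> 2 * R + 1"
      using that by (simp add: path_dist_sym)
    finally have "l (h \<otimes> inv k) \<le> M"
      using that by (intro M(2)) auto
    moreover have "h = (h \<otimes> inv k) \<otimes> k"
      using that by (simp add: m_assoc)
    ultimately show ?thesis
      using length_mult_le[of "h \<otimes> inv k" k] that by simp
  qed
  have chain: "\<exists>h \<in> carrier G. ?d y (\<psi> h q) \<le> R \<and> l h \<le> M * real n"
    if "pl_path Y q L y" "L \<le> real n" for n L y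
    using that
  proof (induction n arbitrary: L y)
    case 0
    then have "?d q y \<le> 0"
      using path_dist_le[OF 0(1)] by simp
    then have "q = y"
      using pl_path_ends[OF 0(1)] Metric_space.nonneg[OF metric, of q y] Metric_space.zero[OF metric, of q y]
      by simp
    then show ?case
      using \<open>0 \<le> R\<close> q A1[of \<one>] Metric_space.zero[OF metric, of q q]
      by (intro bexI[of _ \<one>]) (auto simp: act_one)
  next
    case (Suc n)
    obtain z where z: "pl_path Y q (min L (real n)) z" "pl_path Y z (L - min L (real n)) y"
      using pl_path_split[OF Suc.prems(1), of "min L (real n)"] pl_path_ends(3)[OF Suc.prems(1)] by auto
    obtain k where k: "k \<in> carrier G" "?d z (\<psi> k q) \<le> R" "l k \<le> M * real n"
      using Suc.IH[OF z(1)] by auto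
    have zy: "z \<in> points Y" "y \<in> points Y"
      using pl_path_ends[OF z(2)] by auto
    obtain h where h: "h \<in> carrier G" "?d y (\<psi> h q) \<le> R"
      using R[OF zy(2)] by blast
    have "?d z y \<le> 1"
      using path_dist_le[OF z(2)] Suc.prems(2) by simp
    then have "l h \<le> l k + M"
      using jump k h zy by blast
    then show ?case
      using h k(3) by (intro bexI[of _ h]) (auto simp: algebra_simps)
  qed
  have bound: "l g \<le> M * (?l g + 3)" if g: "g \<in> carrier G" for g
  proof -
    have gq: "\<psi> g q \<in> points Y"
      using g q by (simp add: act_closed)
    obtain L where L: "L < ?l g + 1" "pl_path Y q L (\<psi> g q)"
      using path_dist_approx[OF q gq, of 1] by (auto simp: based_length_def)
    define n where "n = nat \<lceil>L\<rceil>"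
    have n: "L \<le> real n" "real n \<le> ?l g + 2"
      using L(1) pl_path_ends(3)[OF L(2)] by (auto simp: n_def) linarith
    obtain h where h: "h \<in> carrier G" "?d (\<psi> g q) (\<psi> h q) \<le> R" "l h \<le> M * real n"
      using chain[OF L(2) n(1)] by blast
    have "l g \<le> l h + M"
      using jump[OF h(1) g gq gq h(2)] \<open>0 \<le> R\<close> gq Metric_space.zero[OF metric gq gq] by simp
    also have "\<dots> \<le> M * (real n + 1)"
      using h(3) by (simp add: algebra_simps)
    also have "\<dots> \<le> M * (?l g + 3)"
      using n(2) M(1) by (intro mult_left_mono) auto
    finally show ?thesis .
  qed
  \<comment> \<open>The additive constant is absorbed, as \<open>?l\<close> is bounded away from zero off the identity.\<close>
  define L where "L = insert 1 (?l ` ({g \<in> carrier G. ?l g \<le> 1} - {\<one>}))"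
  have finL: "finite L"
    using fin[of 1] by (simp add: L_def)
  have "0 < ?l g" if "g \<in> carrier G" "g \<noteq> \<one>" for g
  proof -
    have "\<psi> g q \<noteq> q"
      using stab that by (auto simp: stabilizer_def)
    then show ?thesis
      using Metric_space.zero[OF metric, of q "\<psi> g q"] path_dist_nonneg[of q "\<psi> g q"] q that
      by (auto simp: based_length_def act_closed order_less_le)
  qed
  then have "\<And>y. y \<in> L \<Longrightarrow> 0 < y"
    by (auto simp: L_def)
  then have c: "0 < Min L"
    using finL by (simp add: L_def)
  have c_le: "Min L \<le> ?l g" if "g \<in> carrier G" "g \<noteq> \<one>" for g
  proof (cases "?l g \<le> 1")
    case True
    then show ?thesis
      using that finL by (intro Min_le) (auto simp: L_def)
  next
    case False
    have "Min L \<le> 1"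
      using finL by (intro Min_le) (auto simp: L_def)
    then show ?thesis
      using False by simp
  qed
  have "l g \<le> M * (1 + 3 / Min L) * ?l g" if g: "g \<in> carrier G" for g
  proof (cases "g = \<one>")
    case True
    then show ?thesis
      using A1[of \<one>] M(1) c path_dist_nonneg[of q "\<psi> \<one> q"] by (simp add: based_length_def)
  next
    case False
    have "3 = 3 / Min L * Min L"
      using c by simp
    also have "\<dots> \<le> 3 / Min L * ?l g"
      using c c_le[OF g False] by (intro mult_left_mono) auto
    finally have "M * (?l g + 3) \<le> M * (?l g + 3 / Min L * ?l g)"
      using M(1) by (intro mult_left_mono) auto
    then show ?thesis
      using bound[OF g] by (simp add: algebra_simps)
  qed
  then show ?thesis
    using M(1) c by (intro exI[of _ "M * (1 + 3 / Min L)"]) simp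
qed

lemma bi_Lipschitz_equivalent_based_length:
  fixes Y :: "('v, 'e) edge_data"
  assumes Y: "metric_G_graph G Y \<psi>" and "locally_compact_space (cw_topology Y)"
    and "cocompact G Y \<psi>" and q: "q \<in> points Y" and "stabilizer G \<psi> q = {\<one>}"
  shows "bi_Lipschitz_equivalent_on (carrier G) l (based_length Y \<psi> q)"
proof -
  interpret metric_G_graph G Y \<psi>
    by (rule Y)
  let ?l = "based_length Y \<psi> q"
  have "?l \<one> \<le> 0"
    using Metric_space.zero[OF metric q q] q by (simp add: based_length_def act_one)
  then obtain C where C: "0 \<le> C" "\<And>g. g \<in> carrier G \<Longrightarrow> ?l g \<le> C * l g"
    using subadditive_le_length[of ?l] based_length_mult_le[OF q] by blast
  obtain D where D: "0 \<le> D" "\<And>g. g \<in> carrier G \<Longrightarrow> l g \<le> D * ?l g"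
    using length_le_based_length[OF assms] by blast
  define A where "A = max 1 (max C D)"
  have A: "1 \<le> A" "C \<le> A" "D \<le> A"
    by (auto simp: A_def)
  have "1 / A * l g \<le> ?l g \<and> ?l g \<le> A * l g" if g: "g \<in> carrier G" for g
  proof
    have "D * ?l g \<le> A * ?l g" "C * l g \<le> A * l g"
      using A path_dist_nonneg nonneg[OF g] by (auto simp: based_length_def intro!: mult_right_mono)
    then have "l g \<le> A * ?l g"
      using D(2)[OF g] by simp
    then show "1 / A * l g \<le> ?l g"
      using A(1) by (simp add: field_simps)
    show "?l g \<le> A * l g"
      using C(2)[OF g] \<open>C * l g \<le> A * l g\<close> by simp
  qed
  then show ?thesis
    using A(1) unfolding bi_Lipschitz_equivalent_on_def by blast
qed

end

section \<open>Cayley graphs\<close>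

text \<open>
  The edge \<open>(x, s)\<close> runs from \<open>x\<close> to \<open>s \<otimes> x\<close>, so that right multiplication maps edges to edges.
\<close>

definition cayley_graph :: "('a, 'm) monoid_scheme \<Rightarrow> 'a set \<Rightarrow> ('a, 'a \<times> 'a) edge_data" where
  "cayley_graph G S = \<lparr>verts = carrier G, edges = carrier G \<times> S, origin = fst,
     terminus = (\<lambda>(x, s). s \<otimes>\<^bsub>G\<^esub> x), len = (\<lambda>_. 1)\<rparr>"

definition cayley_action ::
    "('a, 'm) monoid_scheme \<Rightarrow> 'a \<Rightarrow> ('a, 'a \<times> 'a) point \<Rightarrow> ('a, 'a \<times> 'a) point" where
  "cayley_action G g p = (case p of Vertex x \<Rightarrow> Vertex (x \<otimes>\<^bsub>G\<^esub> g)
     | Inner e t \<Rightarrow> Inner (fst e \<otimes>\<^bsub>G\<^esub> g, snd e) t)"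

lemma cayley_graph_simps [simp]:
  "verts (cayley_graph G S) = carrier G" "edges (cayley_graph G S) = carrier G \<times> S"
  "origin (cayley_graph G S) e = fst e" "terminus (cayley_graph G S) e = snd e \<otimes>\<^bsub>G\<^esub> fst e"
  "len (cayley_graph G S) e = 1"
  by (simp_all add: cayley_graph_def case_prod_beta)

lemma cayley_action_simps [simp]:
  "cayley_action G g (Vertex x) = Vertex (x \<otimes>\<^bsub>G\<^esub> g)"
  "cayley_action G g (Inner e t) = Inner (fst e \<otimes>\<^bsub>G\<^esub> g, snd e) t"
  by (simp_all add: cayley_action_def)

context group
begin

lemma weighted_graph_cayley: "S \<subseteq> carrier G \<Longrightarrow> weighted_graph (cayley_graph G S)"
  by unfold_locales auto

lemma cayley_action_char_map:
  assumes "S \<subseteq> carrier G" "g \<in> carrier G" "e \<in> carrier G \<times> S"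
  shows "cayley_action G g (char_map (cayley_graph G S) e t)
    = char_map (cayley_graph G S) (fst e \<otimes> g, snd e) t"
  using assms by (auto simp: char_map_def m_assoc)

lemma pl_path_cayley_action:
  assumes S: "S \<subseteq> carrier G" and g: "g \<in> carrier G"
    and "pl_path (cayley_graph G S) x L y"
  shows "pl_path (cayley_graph G S) (cayley_action G g x) L (cayley_action G g y)"
  using assms(3)
proof (induction rule: pl_path.induct)
  case (trivial x)
  interpret weighted_graph "cayley_graph G S"
    by (rule weighted_graph_cayley[OF S])
  show ?case
    using trivial g S by (intro pl_path.trivial) (cases x, auto)
next
  case (segment x L e s t)
  then have "pl_path (cayley_graph G S) (cayley_action G g x) (L + \<bar>t - s\<bar>)
      (char_map (cayley_graph G S) (fst e \<otimes> g, snd e) t)"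
    using g by (intro pl_path.segment) (auto simp: cayley_action_char_map[OF S g])
  then show ?case
    using segment.hyps by (simp add: cayley_action_char_map[OF S g])
qed

text \<open>
  A path from the identity to \<open>h1\<close>, translated by \<open>h2\<close>, continues a path from the identity to
  \<open>h2\<close> up to the product \<open>h1 \<otimes> h2\<close>.
\<close>

lemma path_connected_cayley:
  assumes S: "S \<subseteq> carrier G" and gen: "generate G S = carrier G"
  shows "path_connected_graph (cayley_graph G S)"
proof -
  let ?\<Gamma> = "cayley_graph G S"
  interpret weighted_graph ?\<Gamma>
    by (rule weighted_graph_cayley[OF S])
  have edge: "pl_path ?\<Gamma> (Vertex x) 1 (Vertex (s \<otimes> x))" if "x \<in> carrier G" "s \<in> S" for x s
    using pl_path_edge[of "(x, s)" 0 1] char_map_terminus[of "(x, s)"] that by simp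
  have from_one: "\<exists>L. pl_path ?\<Gamma> (Vertex \<one>) L (Vertex g)" if "g \<in> generate G S" for g
    using that
  proof (induction rule: generate.induct)
    case one
    show ?case
      using pl_path.trivial[of "Vertex \<one>" ?\<Gamma>] by auto
  next
    case (incl h)
    then have "h \<in> carrier G"
      using S by blast
    then show ?case
      using edge[of \<one> h] incl by auto
  next
    case (inv h)
    then have "h \<in> carrier G"
      using S by blast
    then show ?case
      using pl_path_sym[OF edge[of "inv h" h]] inv by auto
  next
    case (eng h1 h2)
    then obtain L M where L: "pl_path ?\<Gamma> (Vertex \<one>) L (Vertex h1)" "pl_path ?\<Gamma> (Vertex \<one>) M (Vertex h2)"
      by blast
    have "h2 \<in> carrier G"
      using eng gen by simp
    then show ?case
      using pl_path_trans[OF pl_path_cayley_action[OF S _ L(1), of h2], of "Vertex \<one>" M] L(2) by auto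
  qed
  have to_point: "\<exists>L. pl_path ?\<Gamma> (Vertex \<one>) L x" if x: "x \<in> points ?\<Gamma>" for x
  proof -
    obtain v where "v \<in> carrier G" "pl_path ?\<Gamma> x (depth x) (Vertex v)"
      using nearest_vertex[OF x] by auto
    then show ?thesis
      using from_one[of v] gen pl_path_sym pl_path_trans by metis
  qed
  show ?thesis
    using to_point pl_path_sym pl_path_trans by unfold_locales metis
qed

lemma metric_G_graph_cayley:
  assumes S: "S \<subseteq> carrier G" "S \<noteq> {}" and gen: "generate G S = carrier G"
  shows "metric_G_graph G (cayley_graph G S) (cayley_action G)"
proof -
  let ?\<Gamma> = "cayley_graph G S" and ?\<phi> = "cayley_action G"
  interpret path_connected_graph ?\<Gamma>
    by (rule path_connected_cayley[OF S(1) gen])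
  have closed: "?\<phi> g x \<in> points ?\<Gamma>" if "g \<in> carrier G" "x \<in> points ?\<Gamma>" for g x
    using that by (cases x) auto
  have act_mult: "?\<phi> (g \<otimes> h) x = ?\<phi> h (?\<phi> g x)"
    if "g \<in> carrier G" "h \<in> carrier G" "x \<in> points ?\<Gamma>" for g h x
    using that by (cases x) (auto simp: m_assoc)
  have act_one: "?\<phi> \<one> x = x" if "x \<in> points ?\<Gamma>" for x
    using that by (cases x) auto
  have isometric: "path_dist ?\<Gamma> (?\<phi> g x) (?\<phi> g y) = path_dist ?\<Gamma> x y"
    if g: "g \<in> carrier G" and xy: "x \<in> points ?\<Gamma>" "y \<in> points ?\<Gamma>" for g x y
  proof -
    have "pl_path ?\<Gamma> x L y" if "pl_path ?\<Gamma> (?\<phi> g x) L (?\<phi> g y)" for L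
      using pl_path_cayley_action[OF S(1) _ that, of "inv g"] g xy
      by (simp add: act_mult[symmetric] act_one)
    then have "{L. pl_path ?\<Gamma> (?\<phi> g x) L (?\<phi> g y)} = {L. pl_path ?\<Gamma> x L y}"
      using pl_path_cayley_action[OF S(1) g] by blast
    then show ?thesis
      using closed[OF g] xy by (simp add: path_dist_def)
  qed
  show ?thesis
  proof (intro metric_G_graph.intro metric_graph.intro metric_G_graph_axioms.intro group_axioms)
    show "connected_space (cw_topology ?\<Gamma>)"
      by (simp add: connected_space_iff_path_connected path_connected_graph_axioms)
    show "Metric_space (points ?\<Gamma>) (path_dist ?\<Gamma>)"
      by (rule Metric_space_path_dist[of 1]) auto
    show "\<exists>e' \<in> edges ?\<Gamma>. ?\<phi> g ` open_edge ?\<Gamma> e = open_edge ?\<Gamma> e'"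
      if "g \<in> carrier G" "e \<in> edges ?\<Gamma>" for g e
      using that by (intro bexI[of _ "(fst e \<otimes> g, snd e)"]) (auto simp: open_edge_def image_image)
  qed (use S closed act_mult act_one isometric in auto)
qed

lemma locally_compact_cayley:
  assumes S: "S \<subseteq> carrier G" "finite S"
  shows "locally_compact_space (cw_topology (cayley_graph G S))"
proof -
  interpret weighted_graph "cayley_graph G S"
    by (rule weighted_graph_cayley[OF S(1)])
  show ?thesis
  proof (rule locally_compact_if_finite_stars)
    fix v
    assume v: "v \<in> verts (cayley_graph G S)"
    have "star v \<subseteq> {v} \<times> S \<union> (\<lambda>s. (inv s \<otimes> v, s)) ` S"
      using S(1) by (force simp: star_def m_assoc[symmetric])
    then show "finite (star v)"
      by (rule finite_subset) (simp add: S(2))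
  qed
qed

lemma cocompact_cayley:
  assumes S: "S \<subseteq> carrier G" "finite S" "S \<noteq> {}" and gen: "generate G S = carrier G"
  shows "cocompact G (cayley_graph G S) (cayley_action G)"
proof -
  let ?\<Gamma> = "cayley_graph G S"
  interpret metric_G_graph G ?\<Gamma> "cayley_action G"
    by (rule metric_G_graph_cayley[OF S(1,3) gen])
  let ?K = "\<Union>s \<in> S. char_map ?\<Gamma> (\<one>, s) ` {0..len ?\<Gamma> (\<one>, s)}"
  show ?thesis
  proof (rule cocompact_if_compact_translates_cover)
    show "compactin (cw_topology ?\<Gamma>) ?K"
      using S(2) compactin_closed_edge by (intro compactin_Union) auto
    fix x
    assume "x \<in> points ?\<Gamma>"
    then show "\<exists>g \<in> carrier G. x \<in> cayley_action G g ` ?K"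
    proof (cases x rule: points_cases)
      case (Vertex v)
      obtain s where "s \<in> S"
        using S(3) by blast
      moreover have "x = cayley_action G v (char_map ?\<Gamma> (\<one>, s) 0)"
        using Vertex by simp
      ultimately show ?thesis
        using Vertex by (intro bexI[of _ v]) force+
    next
      case (Inner e t)
      then have "x = cayley_action G (fst e) (char_map ?\<Gamma> (\<one>, snd e) t)"
        by (auto simp: char_map_def)
      moreover have "snd e \<in> S" "t \<in> {0..len ?\<Gamma> (\<one>, snd e)}"
        using Inner by auto
      ultimately have "x \<in> cayley_action G (fst e) ` ?K"
        by blast
      moreover have "fst e \<in> carrier G"
        using Inner by auto
      ultimately show ?thesis
        by blast
    qed
  qed
qed

lemma stabilizer_cayley: "stabilizer G (cayley_action G) (Vertex \<one>) = {\<one>}"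
  by (auto simp: stabilizer_def)

end

section \<open>Comparison with based length functions\<close>

theorem theorem4p8:
  fixes G :: "('a, 'm) monoid_scheme" and l :: "'a \<Rightarrow> real"
  assumes "graph_like_length G l"
  shows
    "(\<exists>(\<Gamma> :: ('a, 'a \<times> 'a) edge_data) \<phi> p.
        metric_G_graph G \<Gamma> \<phi> \<and> locally_compact_space (cw_topology \<Gamma>) \<and> cocompact G \<Gamma> \<phi> \<and>
        p \<in> points \<Gamma> \<and> stabilizer G \<phi> p = {\<one>\<^bsub>G\<^esub>} \<and>
        bi_Lipschitz_equivalent_on (carrier G) l (based_length \<Gamma> \<phi> p)) \<and>
     (\<forall>(Y :: ('v, 'e) edge_data) \<psi> q.
        metric_G_graph G Y \<psi> \<longrightarrow> locally_compact_space (cw_topology Y) \<longrightarrow> cocompact G Y \<psi> \<longrightarrow>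
        q \<in> points Y \<longrightarrow> stabilizer G \<psi> q = {\<one>\<^bsub>G\<^esub>} \<longrightarrow>
        bi_Lipschitz_equivalent_on (carrier G) l (based_length Y \<psi> q))"
proof
  interpret graph_like_length G l
    by (rule assms)
  obtain K where K: "0 < K" "generate G {g \<in> carrier G. l g \<le> K} = carrier G"
    by (rule generated_by_ball)
  \<comment> \<open>\<open>S\<close> contains the identity, so the Cayley graph of the trivial group has an edge, a loop.\<close>
  define S where "S = {g \<in> carrier G. l g \<le> K}"
  have "\<one>\<^bsub>G\<^esub> \<in> S"
    using A1[of "\<one>\<^bsub>G\<^esub>"] K(1) by (simp add: S_def)
  then have S: "S \<subseteq> carrier G" "finite S" "S \<noteq> {}" and gen: "generate G S = carrier G"
    using A4[of K] K by (auto simp: S_def)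
  note cayley = metric_G_graph_cayley[OF S(1,3) gen] locally_compact_cayley[OF S(1,2)]
    cocompact_cayley[OF S gen]
  have p: "Vertex \<one>\<^bsub>G\<^esub> \<in> points (cayley_graph G S)"
    by (simp add: points_def)
  show "\<exists>(\<Gamma> :: ('a, 'a \<times> 'a) edge_data) \<phi> p.
        metric_G_graph G \<Gamma> \<phi> \<and> locally_compact_space (cw_topology \<Gamma>) \<and> cocompact G \<Gamma> \<phi> \<and>
        p \<in> points \<Gamma> \<and> stabilizer G \<phi> p = {\<one>\<^bsub>G\<^esub>} \<and>
        bi_Lipschitz_equivalent_on (carrier G) l (based_length \<Gamma> \<phi> p)"
    using cayley p stabilizer_cayley bi_Lipschitz_equivalent_based_length[OF cayley p stabilizer_cayley]
    by blast
  show "\<forall>(Y :: ('v, 'e) edge_data) \<psi> q.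
        metric_G_graph G Y \<psi> \<longrightarrow> locally_compact_space (cw_topology Y) \<longrightarrow> cocompact G Y \<psi> \<longrightarrow>
        q \<in> points Y \<longrightarrow> stabilizer G \<psi> q = {\<one>\<^bsub>G\<^esub>} \<longrightarrow>
        bi_Lipschitz_equivalent_on (carrier G) l (based_length Y \<psi> q)"
    using bi_Lipschitz_equivalent_based_length by blast
qed

end
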